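(* Let $\rho=(12)(45)(78)$ and $\mu_{4,0}(n)=4n \bmod 9$ (so $\mu_{4,0}=(147)(285)$), as permutations of $\{0,\dots,8\}$. Then $H_{mm}\times\langle\rho,\mu_{4,0}\rangle$ is a minimal complete modular-magic Sudoku symmetry group: its orbits on the set of modular-magic Sudoku boards coincide with the orbits of $G_{mm}$ (so there are exactly two of them), and no subgroup of $G_{mm}$ of smaller order has orbits coinciding with those of $G_{mm}$.
   Context: A Sudoku board is a $9\times 9$ array with entries from $\{0,\dots,8\}$ such that every row, every column, and every one of the nine $3\times 3$ blocks contains each symbol exactly once. A modular-magic Sudoku board is a Sudoku board in which, for every block, the entries of each of its three rows, three columns and two diagonals sum to a multiple of $9$. The physical Sudoku symmetry group $H_9$ is the group of rearrangements of the $81$ cells generated by permutations of the three bands (horizontal strips of blocks), permutations of the rows within a band, permutations of the three pillars (vertical strips of blocks), permutations of the columns within a pillar, and the transpose. $H_{mm}$ is the subgroup of $H_9$ of elements mapping every modular-magic board to a modular-magic board (order $4608$). A relabeling is a permutation of the symbols $\{0,\dots,8\}$ applied to every entry. $S_{mm}$ is the group of relabelings generated by $\rho=(12)(45)(78)$ and the maps $\mu_{k,l}(n)=kn+l \bmod 9$ for $k\in\{1,2,4,5,7,8\}$, $l\in\{0,3,6\}$ (it has order $36$ and consists of the relabelings preserving modular-magic boards). $G_{mm}=H_{mm}\times S_{mm}$ acts on the set of modular-magic boards; it is known to have exactly two orbits. *)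

theory Defs
  imports "HOL-Algebra.Algebra" "HOL-Combinatorics.Permutations"
begin

definition Cells :: "(nat \<times> nat) set" where
  "Cells = {0..<9} \<times> {0..<9}"

definition Syms :: "nat set" where
  "Syms = {0..<9}"

definition is_board :: "(nat \<times> nat \<Rightarrow> nat) \<Rightarrow> bool" where
  "is_board b \<longleftrightarrow> b \<in> Cells \<rightarrow>\<^sub>E Syms"

definition block :: "nat \<Rightarrow> nat \<Rightarrow> (nat \<times> nat) set" where
  "block I J = {3 * I ..< 3 * I + 3} \<times> {3 * J ..< 3 * J + 3}"

definition sudoku :: "(nat \<times> nat \<Rightarrow> nat) \<Rightarrow> bool" where
  "sudoku b \<longleftrightarrow> is_board b
     \<and> (\<forall>r<9. bij_betw (\<lambda>c. b (r, c)) {0..<9} Syms)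
     \<and> (\<forall>c<9. bij_betw (\<lambda>r. b (r, c)) {0..<9} Syms)
     \<and> (\<forall>I<3. \<forall>J<3. bij_betw b (block I J) Syms)"

definition modmagic :: "(nat \<times> nat \<Rightarrow> nat) \<Rightarrow> bool" where
  "modmagic b \<longleftrightarrow> sudoku b \<and>
     (\<forall>I<3. \<forall>J<3.
        (\<forall>i<3. (\<Sum>j<3. b (3 * I + i, 3 * J + j)) mod 9 = 0)
      \<and> (\<forall>j<3. (\<Sum>i<3. b (3 * I + i, 3 * J + j)) mod 9 = 0)
      \<and> (\<Sum>k<3. b (3 * I + k, 3 * J + k)) mod 9 = 0
      \<and> (\<Sum>k<3. b (3 * I + k, 3 * J + (2 - k))) mod 9 = 0)"

definition MM :: "(nat \<times> nat \<Rightarrow> nat) set" where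
  "MM = {b. modmagic b}"

definition band_perm :: "(nat \<Rightarrow> nat) \<Rightarrow> nat \<times> nat \<Rightarrow> nat \<times> nat" where
  "band_perm \<sigma> = (\<lambda>(r, c) \<in> Cells. (3 * \<sigma> (r div 3) + r mod 3, c))"

definition row_perm :: "nat \<Rightarrow> (nat \<Rightarrow> nat) \<Rightarrow> nat \<times> nat \<Rightarrow> nat \<times> nat" where
  "row_perm k \<sigma> = (\<lambda>(r, c) \<in> Cells. (if r div 3 = k then 3 * k + \<sigma> (r mod 3) else r, c))"

definition pillar_perm :: "(nat \<Rightarrow> nat) \<Rightarrow> nat \<times> nat \<Rightarrow> nat \<times> nat" where
  "pillar_perm \<sigma> = (\<lambda>(r, c) \<in> Cells. (r, 3 * \<sigma> (c div 3) + c mod 3))"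

definition col_perm :: "nat \<Rightarrow> (nat \<Rightarrow> nat) \<Rightarrow> nat \<times> nat \<Rightarrow> nat \<times> nat" where
  "col_perm k \<sigma> = (\<lambda>(r, c) \<in> Cells. (r, if c div 3 = k then 3 * k + \<sigma> (c mod 3) else c))"

definition transp :: "nat \<times> nat \<Rightarrow> nat \<times> nat" where
  "transp = (\<lambda>(r, c) \<in> Cells. (c, r))"

definition H9_gens :: "(nat \<times> nat \<Rightarrow> nat \<times> nat) set" where
  "H9_gens =
     {band_perm \<sigma> | \<sigma>. \<sigma> permutes {0..<3}}
   \<union> {row_perm k \<sigma> | k \<sigma>. k < 3 \<and> \<sigma> permutes {0..<3}}
   \<union> {pillar_perm \<sigma> | \<sigma>. \<sigma> permutes {0..<3}}
   \<union> {col_perm k \<sigma> | k \<sigma>. k < 3 \<and> \<sigma> permutes {0..<3}}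
   \<union> {transp}"

definition H9 :: "(nat \<times> nat \<Rightarrow> nat \<times> nat) set" where
  "H9 = generate (BijGroup Cells) H9_gens"

definition rho :: "nat \<Rightarrow> nat" where
  "rho = (\<lambda>n \<in> Syms. if n mod 3 = 1 then n + 1 else if n mod 3 = 2 then n - 1 else n)"

definition mu :: "nat \<Rightarrow> nat \<Rightarrow> nat \<Rightarrow> nat" where
  "mu k l = (\<lambda>n \<in> Syms. (k * n + l) mod 9)"

definition Smm :: "(nat \<Rightarrow> nat) set" where
  "Smm = generate (BijGroup Syms)
           ({rho} \<union> {mu k l | k l. k \<in> {1, 2, 4, 5, 7, 8} \<and> l \<in> {0, 3, 6}})"

text \<open>(h, s) moves the entry of cell x to cell h x and relabels it by s.\<close>
definition act :: "(nat \<times> nat \<Rightarrow> nat \<times> nat) \<times> (nat \<Rightarrow> nat)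
                    \<Rightarrow> (nat \<times> nat \<Rightarrow> nat) \<Rightarrow> (nat \<times> nat \<Rightarrow> nat)" where
  "act g b = (\<lambda>x \<in> Cells. snd g (b (inv_into Cells (fst g) x)))"

definition Hmm :: "(nat \<times> nat \<Rightarrow> nat \<times> nat) set" where
  "Hmm = {h \<in> H9. \<forall>b \<in> MM. act (h, \<lambda>n \<in> Syms. n) b \<in> MM}"

definition SymProd :: "((nat \<times> nat \<Rightarrow> nat \<times> nat) \<times> (nat \<Rightarrow> nat)) monoid" where
  "SymProd = BijGroup Cells \<times>\<times> BijGroup Syms"

definition Gmm :: "((nat \<times> nat \<Rightarrow> nat \<times> nat) \<times> (nat \<Rightarrow> nat)) set" where
  "Gmm = Hmm \<times> Smm"

definition orbit :: "((nat \<times> nat \<Rightarrow> nat \<times> nat) \<times> (nat \<Rightarrow> nat)) set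
                      \<Rightarrow> (nat \<times> nat \<Rightarrow> nat) \<Rightarrow> (nat \<times> nat \<Rightarrow> nat) set" where
  "orbit K b = {act g b | g. g \<in> K}"

definition same_orbits :: "((nat \<times> nat \<Rightarrow> nat \<times> nat) \<times> (nat \<Rightarrow> nat)) set \<Rightarrow> bool" where
  "same_orbits K \<longleftrightarrow> (\<forall>b \<in> MM. orbit K b = orbit Gmm b)"

definition K0 :: "((nat \<times> nat \<Rightarrow> nat \<times> nat) \<times> (nat \<Rightarrow> nat)) set" where
  "K0 = Hmm \<times> generate (BijGroup Syms) {rho, mu 4 0}"

end

theory Submission
  imports Defs
begin

text \<open>The residues modulo 3 in a modular-magic block form one of two diagonal patterns, and its center is
  0, 3 or 6. Permuting bands and pillars turns the centers into a fixed Latin square, and reversing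
  rows and columns inside bands and pillars then puts all multiples of 3 into fixed positions. After
  a relabeling from \<open>\<langle>\<rho>, \<mu>\<^bsub>4,0\<^esub>\<rangle>\<close> only seven boards remain; six of them are equivalent and the seventh
  is separated from them by the number of distinct symbol sets in the rows and columns of blocks,
  which is 9 for the former and 6 for the latter.

  The stabilizer in \<open>K0\<close> of a board of the first kind is trivial, so its orbit has \<open>card K0\<close>
  elements. A group with the same orbits therefore has at least \<open>card K0\<close> elements.\<close>

subsection \<open>Group actions on boards\<close>

lemma (in group) finite_subgroupI:
  assumes "finite (carrier G)" "H \<subseteq> carrier G" "\<one> \<in> H"
    and closed: "\<And>x y. x \<in> H \<Longrightarrow> y \<in> H \<Longrightarrow> x \<otimes> y \<in> H"
  shows "subgroup H G"
proof (rule subgroupI)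
  fix a assume a: "a \<in> H"
  have pow: "a [^] n \<in> H" for n :: nat
    by (induction n) (simp_all add: assms(3) a closed)
  from a assms have aG: "a \<in> carrier G" by auto
  have "order G > 0" using assms(1) order_gt_0_iff_finite by simp
  then obtain n where n: "order G = Suc n" using gr0_implies_Suc by blast
  have "a [^] n \<otimes> a = \<one>"
    using pow_order_eq_1[OF aG] n by simp
  then have "inv a = a [^] n"
    by (rule inv_equality) (use aG in auto)
  then show "inv a \<in> H" using pow by simp
qed (use assms in auto)

lemma finite_Cells: "finite Cells" and finite_Syms: "finite Syms"
  by (simp_all add: Cells_def Syms_def)

lemma finite_BijGroup:
  assumes "finite S"
  shows "finite (carrier (BijGroup S))"
proof (rule finite_subset)
  show "carrier (BijGroup S) \<subseteq> S \<rightarrow>\<^sub>E S"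
    by (auto simp: BijGroup_def PiE_def dest: Bij_imp_extensional Bij_imp_funcset)
qed (use assms in \<open>simp add: finite_PiE\<close>)

lemma carrier_BijGroup: "carrier (BijGroup S) = Bij S"
  by (simp add: BijGroup_def)

lemma mult_BijGroup: "f \<in> Bij S \<Longrightarrow> g \<in> Bij S \<Longrightarrow> f \<otimes>\<^bsub>BijGroup S\<^esub> g = compose S f g"
  by (simp add: BijGroup_def)

lemma one_BijGroup: "\<one>\<^bsub>BijGroup S\<^esub> = (\<lambda>x\<in>S. x)"
  by (simp add: BijGroup_def)

lemma Bij_bij_betw: "f \<in> Bij S \<Longrightarrow> bij_betw f S S"
  by (simp add: Bij_def)

lemma Bij_mem: "f \<in> Bij S \<Longrightarrow> x \<in> S \<Longrightarrow> f x \<in> S"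
  by (rule funcset_mem[OF Bij_imp_funcset])

lemma Bij_surjE:
  assumes "f \<in> Bij S" "y \<in> S"
  obtains x where "x \<in> S" "y = f x"
  using assms by (auto simp: Bij_def bij_betw_def)

lemma BijI_finite:
  assumes "finite S" "f \<in> extensional S" "\<And>x. x \<in> S \<Longrightarrow> f x \<in> S" "inj_on f S"
  shows "f \<in> Bij S"
  by (simp add: Bij_def bij_betw_def assms endo_inj_surj image_subsetI)

lemma act_in_extensional: "act g b \<in> extensional Cells"
  by (simp add: act_def)

lemma act_apply:
  assumes "h \<in> Bij Cells" "x \<in> Cells"
  shows "act (h, s) b (h x) = s (b x)"
  using assms Bij_mem[OF assms] Bij_bij_betw[OF assms(1)]
  by (simp add: act_def bij_betw_inv_into_left)

text \<open>Every cell has the form \<open>h x\<close>, so comparing values there removes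
  \<open>inv_into\<close> from the computation of images of boards.\<close>

lemma act_eqI:
  assumes "h \<in> Bij Cells" "b' \<in> extensional Cells" "\<And>x. x \<in> Cells \<Longrightarrow> b' (h x) = s (b x)"
  shows "act (h, s) b = b'"
proof (rule extensionalityI[OF act_in_extensional assms(2)])
  fix y assume "y \<in> Cells"
  then obtain x where "x \<in> Cells" "y = h x"
    by (rule Bij_surjE[OF assms(1)])
  then show "act (h, s) b y = b' y"
    using assms(1,3) by (simp add: act_apply)
qed

lemma carrier_SymProd: "carrier SymProd = Bij Cells \<times> Bij Syms"
  by (simp add: SymProd_def DirProd_def BijGroup_def)

lemma group_SymProd: "group SymProd"
  by (simp add: SymProd_def DirProd_group group_BijGroup)

lemma act_mult:
  assumes "g \<in> carrier SymProd" "g' \<in> carrier SymProd" "b \<in> Cells \<rightarrow>\<^sub>E Syms"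
  shows "act (g \<otimes>\<^bsub>SymProd\<^esub> g') b = act g (act g' b)"
proof -
  obtain h s h' s' where g: "g = (h, s)" "g' = (h', s')" by fastforce
  with assms have B: "h \<in> Bij Cells" "h' \<in> Bij Cells" "s \<in> Bij Syms" "s' \<in> Bij Syms"
    by (auto simp: carrier_SymProd)
  have b: "b x \<in> Syms" if "x \<in> Cells" for x
    using assms(3) that by (rule PiE_mem)
  have "act (compose Cells h h', compose Syms s s') b = act (h, s) (act (h', s') b)"
  proof (rule act_eqI)
    fix x assume x: "x \<in> Cells"
    show "act (h, s) (act (h', s') b) (compose Cells h h' x) = compose Syms s s' (b x)"
      using x b[OF x] B by (simp add: compose_eq act_apply Bij_mem)
  qed (simp_all add: B compose_Bij act_in_extensional)
  then show ?thesis using B by (simp add: g SymProd_def mult_BijGroup)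
qed

lemma act_one: "b \<in> Cells \<rightarrow>\<^sub>E Syms \<Longrightarrow> act \<one>\<^bsub>SymProd\<^esub> b = b"
  by (simp add: SymProd_def one_BijGroup, rule act_eqI)
     (auto simp: id_Bij PiE_mem PiE_iff)

lemma orbit_iff: "b' \<in> orbit K b \<longleftrightarrow> (\<exists>g\<in>K. b' = act g b)"
  unfolding orbit_def by blast

lemma orbitI: "g \<in> K \<Longrightarrow> act g b = b' \<Longrightarrow> b' \<in> orbit K b"
  unfolding orbit_iff by blast

lemma orbit_refl:
  assumes "subgroup K SymProd" "b \<in> Cells \<rightarrow>\<^sub>E Syms"
  shows "b \<in> orbit K b"
  using act_one[OF assms(2)] subgroup.one_closed[OF assms(1)] by (rule orbitI[rotated])

lemma orbit_trans:
  assumes "subgroup K SymProd" "b \<in> Cells \<rightarrow>\<^sub>E Syms" "b' \<in> orbit K b" "b'' \<in> orbit K b'"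
  shows "b'' \<in> orbit K b"
proof -
  obtain g g' where g: "g \<in> K" "b' = act g b" "g' \<in> K" "b'' = act g' b'"
    using assms unfolding orbit_iff by blast
  then have "b'' = act (g' \<otimes>\<^bsub>SymProd\<^esub> g) b"
    using act_mult[OF subgroup.mem_carrier[OF assms(1) g(3)] subgroup.mem_carrier[OF assms(1) g(1)] assms(2)] by simp
  then show ?thesis using g subgroup.m_closed[OF assms(1)] by (metis orbitI)
qed

lemma orbit_sym:
  assumes "subgroup K SymProd" "b \<in> Cells \<rightarrow>\<^sub>E Syms" "b' \<in> orbit K b"
  shows "b \<in> orbit K b'"
proof -
  interpret group SymProd by (rule group_SymProd)
  obtain g where g: "g \<in> K" "b' = act g b"
    using assms unfolding orbit_iff by blast
  have gc: "g \<in> carrier SymProd" using g subgroup.mem_carrier[OF assms(1)] by auto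
  have "act (inv\<^bsub>SymProd\<^esub> g) b' = b"
    unfolding g(2) act_mult[OF inv_closed[OF gc] gc assms(2), symmetric] l_inv[OF gc]
    using act_one[OF assms(2)] .
  then show ?thesis using g subgroup.m_inv_closed[OF assms(1)] by (intro orbitI) auto
qed

lemma orbit_eq:
  assumes "subgroup K SymProd" "b \<in> Cells \<rightarrow>\<^sub>E Syms" "b' \<in> Cells \<rightarrow>\<^sub>E Syms" "b' \<in> orbit K b"
  shows "orbit K b' = orbit K b"
proof
  show "orbit K b' \<subseteq> orbit K b"
    by (rule subsetI, rule orbit_trans[OF assms(1,2,4)])
  show "orbit K b \<subseteq> orbit K b'"
    by (rule subsetI, rule orbit_trans[OF assms(1,3) orbit_sym[OF assms(1,2,4)]])
qed

lemma MM_boards: "b \<in> MM \<Longrightarrow> b \<in> Cells \<rightarrow>\<^sub>E Syms"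
  by (simp add: MM_def modmagic_def sudoku_def is_board_def)

subsection \<open>The physical symmetries\<close>

definition cellmap :: "(nat \<Rightarrow> nat) \<Rightarrow> (nat \<Rightarrow> nat) \<Rightarrow> nat \<times> nat \<Rightarrow> nat \<times> nat" where
  "cellmap f g = (\<lambda>(r, c)\<in>Cells. (f r, g c))"

text \<open>Transposition followed by \<open>cellmap f g\<close>; hence \<open>f\<close> is applied
  to the old column index.\<close>

definition tcellmap :: "(nat \<Rightarrow> nat) \<Rightarrow> (nat \<Rightarrow> nat) \<Rightarrow> nat \<times> nat \<Rightarrow> nat \<times> nat" where
  "tcellmap f g = (\<lambda>(r, c)\<in>Cells. (f c, g r))"

text \<open>The wreath product of two symmetric groups of degree 3, acting on nine indices:
  permutations that respect the partition into three consecutive triples.\<close>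

definition wreath :: "(nat \<Rightarrow> nat) \<Rightarrow> bool" where
  "wreath f \<longleftrightarrow> bij_betw f {0..<9} {0..<9} \<and>
     (\<forall>r<9. \<forall>r'<9. r div 3 = r' div 3 \<longrightarrow> f r div 3 = f r' div 3)"

definition bandf :: "(nat \<Rightarrow> nat) \<Rightarrow> nat \<Rightarrow> nat" where
  "bandf \<sigma> r = 3 * \<sigma> (r div 3) + r mod 3"

definition rowf :: "nat \<Rightarrow> (nat \<Rightarrow> nat) \<Rightarrow> nat \<Rightarrow> nat" where
  "rowf k \<sigma> r = (if r div 3 = k then 3 * k + \<sigma> (r mod 3) else r)"

lemma Cells_iff [simp]: "(r, c) \<in> Cells \<longleftrightarrow> r < 9 \<and> c < 9"
  by (auto simp: Cells_def)

lemma wreath_less: "wreath f \<Longrightarrow> r < 9 \<Longrightarrow> f r < 9"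
  unfolding wreath_def using bij_betwE by fastforce

lemma wreath_inj: "wreath f \<Longrightarrow> inj_on f {0..<9}"
  by (simp add: wreath_def bij_betw_def)

lemma wreath_eq_iff: "wreath f \<Longrightarrow> r < 9 \<Longrightarrow> r' < 9 \<Longrightarrow> f r = f r' \<longleftrightarrow> r = r'"
  using wreath_inj[of f] by (auto simp: inj_on_def)

lemma wreath_div: "wreath f \<Longrightarrow> r < 9 \<Longrightarrow> r' < 9 \<Longrightarrow> r div 3 = r' div 3 \<Longrightarrow> f r div 3 = f r' div 3"
  unfolding wreath_def by blast

lemma wreathI:
  assumes "\<And>r. r < 9 \<Longrightarrow> f r < 9" "\<And>r r'. r < 9 \<Longrightarrow> r' < 9 \<Longrightarrow> f r = f r' \<Longrightarrow> r = r'"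
    "\<And>r r'. r < 9 \<Longrightarrow> r' < 9 \<Longrightarrow> r div 3 = r' div 3 \<Longrightarrow> f r div 3 = f r' div 3"
  shows "wreath f"
proof -
  have "inj_on f {0..<9}" using assms(2) by (simp add: inj_on_def)
  moreover have "f ` {0..<9} \<subseteq> {0..<9}" using assms(1) by auto
  ultimately show ?thesis
    using assms(3) unfolding wreath_def bij_betw_def by (metis endo_inj_surj finite_atLeastLessThan)
qed

lemma wreath_id: "wreath id" "wreath (\<lambda>x. x)"
  by (rule wreathI; simp)+

lemma wreath_comp:
  assumes f: "wreath f" and g: "wreath g"
  shows "wreath (\<lambda>x. f (g x))"
proof (rule wreathI)
  fix r r' :: nat assume r: "r < 9" "r' < 9"
  note g_less = wreath_less[OF g r(1)] wreath_less[OF g r(2)]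
  show "f (g r) < 9" by (rule wreath_less[OF f g_less(1)])
  show "r = r'" if "f (g r) = f (g r')"
    using that by (simp add: wreath_eq_iff[OF f g_less] wreath_eq_iff[OF g r])
  show "f (g r) div 3 = f (g r') div 3" if "r div 3 = r' div 3"
    by (rule wreath_div[OF f g_less wreath_div[OF g r that]])
qed

lemma div3_less: "r < 9 \<Longrightarrow> r div 3 < (3::nat)" and mod3_less: "r mod 3 < (3::nat)"
  by auto

lemma permutes3_less: "\<sigma> permutes {0..<3} \<Longrightarrow> i < 3 \<Longrightarrow> \<sigma> i < (3::nat)"
  using permutes_in_image[of \<sigma> "{0..<3}" i] by simp

lemma triple_less: "i < 3 \<Longrightarrow> j < 3 \<Longrightarrow> 3 * i + j < (9::nat)"
  by simp

lemma wreath_bandf: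
  assumes "\<sigma> permutes {0..<3}" shows "wreath (bandf \<sigma>)"
proof (rule wreathI)
  fix r r' :: nat assume "r < 9" "r' < 9"
  have d: "bandf \<sigma> x div 3 = \<sigma> (x div 3)" "bandf \<sigma> x mod 3 = x mod 3" for x
    by (simp_all add: bandf_def)
  show "bandf \<sigma> r < 9"
    unfolding bandf_def by (rule triple_less[OF permutes3_less[OF assms div3_less[OF \<open>r < 9\<close>]] mod3_less])
  show "r = r'" if "bandf \<sigma> r = bandf \<sigma> r'"
  proof -
    have "r div 3 = r' div 3" using d(1)[of r] d(1)[of r'] that permutes_inj[OF assms]
      by (metis injD)
    moreover have "r mod 3 = r' mod 3" using d(2)[of r] d(2)[of r'] that by simp
    ultimately show ?thesis by (metis div_mult_mod_eq)
  qed
  show "bandf \<sigma> r div 3 = bandf \<sigma> r' div 3" if "r div 3 = r' div 3"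
    using that by (simp add: d)
qed

lemma wreath_rowf:
  assumes "\<sigma> permutes {0..<3}" shows "wreath (rowf k \<sigma>)"
proof (rule wreathI)
  fix r r' :: nat assume r: "r < 9" "r' < 9"
  have d: "rowf k \<sigma> x div 3 = x div 3" "rowf k \<sigma> x mod 3 = (if x div 3 = k then \<sigma> (x mod 3) else x mod 3)" for x
    using permutes3_less[OF assms mod3_less[of x]] by (simp_all add: rowf_def)
  show "rowf k \<sigma> r < 9" using d(1)[of r] div3_less[OF r(1)] by linarith
  show "r = r'" if "rowf k \<sigma> r = rowf k \<sigma> r'"
  proof -
    have "r div 3 = r' div 3" using d(1)[of r] d(1)[of r'] that by simp
    moreover have "r mod 3 = r' mod 3" using d(2)[of r] d(2)[of r'] that permutes_inj[OF assms] calculation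
      by (metis injD)
    ultimately show ?thesis by (metis div_mult_mod_eq)
  qed
  show "rowf k \<sigma> r div 3 = rowf k \<sigma> r' div 3" if "r div 3 = r' div 3"
    using that by (simp add: d)
qed

lemma H9_gens_eq:
  "band_perm \<sigma> = cellmap (bandf \<sigma>) id" "pillar_perm \<sigma> = cellmap id (bandf \<sigma>)"
  "row_perm k \<sigma> = cellmap (rowf k \<sigma>) id" "col_perm k \<sigma> = cellmap id (rowf k \<sigma>)"
  "transp = tcellmap id id"
  by (simp_all add: band_perm_def pillar_perm_def row_perm_def col_perm_def transp_def
      cellmap_def tcellmap_def bandf_def rowf_def)

lemma cellmap_Bij: "wreath f \<Longrightarrow> wreath g \<Longrightarrow> cellmap f g \<in> Bij Cells"
  by (rule BijI_finite[OF finite_Cells])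
     (auto simp: cellmap_def wreath_less inj_on_def wreath_eq_iff)

lemma tcellmap_Bij: "wreath f \<Longrightarrow> wreath g \<Longrightarrow> tcellmap f g \<in> Bij Cells"
  by (rule BijI_finite[OF finite_Cells])
     (auto simp: tcellmap_def wreath_less inj_on_def wreath_eq_iff)

text \<open>An explicit group around \<open>H9\<close>. Membership supplies a row map and a column
  map to calculate with, in place of words in the generators.\<close>

definition wreath_maps :: "(nat \<times> nat \<Rightarrow> nat \<times> nat) set" where
  "wreath_maps = {h. \<exists>f g. wreath f \<and> wreath g \<and> (h = cellmap f g \<or> h = tcellmap f g)}"

lemma wreath_maps_Bij: "wreath_maps \<subseteq> Bij Cells"
  by (auto simp: wreath_maps_def cellmap_Bij tcellmap_Bij)

lemma compose_cellmap:
  assumes "wreath f'" "wreath g'"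
  shows "compose Cells (cellmap f g) (cellmap f' g') = cellmap (\<lambda>x. f (f' x)) (\<lambda>x. g (g' x))"
    "compose Cells (cellmap f g) (tcellmap f' g') = tcellmap (\<lambda>x. f (f' x)) (\<lambda>x. g (g' x))"
    "compose Cells (tcellmap f g) (cellmap f' g') = tcellmap (\<lambda>x. f (g' x)) (\<lambda>x. g (f' x))"
    "compose Cells (tcellmap f g) (tcellmap f' g') = cellmap (\<lambda>x. f (g' x)) (\<lambda>x. g (f' x))"
  using assms by (auto simp: compose_def cellmap_def tcellmap_def fun_eq_iff wreath_less)

lemma subgroup_wreath_maps: "subgroup wreath_maps (BijGroup Cells)"
proof (rule group.finite_subgroupI[OF group_BijGroup finite_BijGroup[OF finite_Cells]])
  show "wreath_maps \<subseteq> carrier (BijGroup Cells)"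
    by (simp add: carrier_BijGroup wreath_maps_Bij)
  have "(\<lambda>x\<in>Cells. x) = cellmap id id" by (auto simp: cellmap_def fun_eq_iff)
  then show "\<one>\<^bsub>BijGroup Cells\<^esub> \<in> wreath_maps"
    using wreath_id(1) unfolding one_BijGroup wreath_maps_def by blast
  show "x \<otimes>\<^bsub>BijGroup Cells\<^esub> y \<in> wreath_maps" if xy: "x \<in> wreath_maps" "y \<in> wreath_maps" for x y
  proof -
    have "compose Cells x y \<in> wreath_maps"
    proof -
      obtain f g f' g' where w: "wreath f" "wreath g" "wreath f'" "wreath g'"
        and eq: "x = cellmap f g \<or> x = tcellmap f g" "y = cellmap f' g' \<or> y = tcellmap f' g'"
        using xy unfolding wreath_maps_def by blast
      note c = compose_cellmap[OF w(3,4), of f g]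
        wreath_comp[OF w(1,3)] wreath_comp[OF w(2,4)] wreath_comp[OF w(1,4)] wreath_comp[OF w(2,3)]
      show ?thesis
        using eq c unfolding wreath_maps_def mem_Collect_eq by metis
    qed
    then show ?thesis using xy wreath_maps_Bij mult_BijGroup by (metis subsetD)
  qed
qed

lemma H9_gens_wreath: "H9_gens \<subseteq> wreath_maps"
  unfolding H9_gens_def H9_gens_eq wreath_maps_def
  using wreath_id(1) wreath_bandf wreath_rowf by blast

lemma H9_wreath: "H9 \<subseteq> wreath_maps"
  unfolding H9_def
  by (rule group.generate_subgroup_incl[OF group_BijGroup H9_gens_wreath subgroup_wreath_maps])

lemma subgroup_H9: "subgroup H9 (BijGroup Cells)"
  unfolding H9_def
  by (rule group.generate_is_subgroup[OF group_BijGroup])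
     (use H9_gens_wreath wreath_maps_Bij in \<open>auto simp: carrier_BijGroup\<close>)

lemma H9_Bij: "H9 \<subseteq> Bij Cells"
  using H9_wreath wreath_maps_Bij by blast

lemma id_Syms_Bij: "(\<lambda>n\<in>Syms. n) \<in> Bij Syms" by (rule id_Bij)

lemma Hmm_sub: "Hmm \<subseteq> H9" by (auto simp: Hmm_def)

lemma subgroup_Hmm: "subgroup Hmm (BijGroup Cells)"
proof (rule group.finite_subgroupI[OF group_BijGroup finite_BijGroup[OF finite_Cells]])
  show "Hmm \<subseteq> carrier (BijGroup Cells)"
    using Hmm_sub H9_Bij by (simp add: carrier_BijGroup)
  have "\<one>\<^bsub>BijGroup Cells\<^esub> \<in> H9" using subgroup.one_closed[OF subgroup_H9] .
  moreover have "act (\<one>\<^bsub>BijGroup Cells\<^esub>, \<lambda>n\<in>Syms. n) b = b" if "b \<in> MM" for b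
    using act_one[OF MM_boards[OF that]] by (simp add: SymProd_def one_BijGroup)
  ultimately show "\<one>\<^bsub>BijGroup Cells\<^esub> \<in> Hmm" by (simp add: Hmm_def)
  show "x \<otimes>\<^bsub>BijGroup Cells\<^esub> y \<in> Hmm" if xy: "x \<in> Hmm" "y \<in> Hmm" for x y
  proof -
    have c: "(x, \<lambda>n\<in>Syms. n) \<in> carrier SymProd" "(y, \<lambda>n\<in>Syms. n) \<in> carrier SymProd"
      using xy Hmm_sub H9_Bij id_Syms_Bij by (auto simp: carrier_SymProd)
    have "act (x \<otimes>\<^bsub>BijGroup Cells\<^esub> y, \<lambda>n\<in>Syms. n) b \<in> MM" if b: "b \<in> MM" for b
    proof -
      have "act (x \<otimes>\<^bsub>BijGroup Cells\<^esub> y, \<lambda>n\<in>Syms. n) b = act ((x, \<lambda>n\<in>Syms. n) \<otimes>\<^bsub>SymProd\<^esub> (y, \<lambda>n\<in>Syms. n)) b"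
        using id_Syms_Bij by (simp add: SymProd_def mult_BijGroup)
      also have "\<dots> = act (x, \<lambda>n\<in>Syms. n) (act (y, \<lambda>n\<in>Syms. n) b)"
        by (rule act_mult[OF c MM_boards[OF b]])
      also have "\<dots> \<in> MM" using xy b by (simp add: Hmm_def)
      finally show ?thesis .
    qed
    moreover have "x \<otimes>\<^bsub>BijGroup Cells\<^esub> y \<in> H9"
      using xy Hmm_sub subgroup.m_closed[OF subgroup_H9] by blast
    ultimately show ?thesis by (simp add: Hmm_def)
  qed
qed

subsection \<open>Symmetries preserving the modular-magic property\<close>

lemma all_less_3: "(\<forall>i<3. P i) \<longleftrightarrow> P 0 \<and> P 1 \<and> P (2::nat)"
proof -
  have "i < 3 \<longleftrightarrow> i = 0 \<or> i = 1 \<or> i = 2" for i :: nat by arith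
  then show ?thesis by auto
qed

lemma sum_less_3: "(\<Sum>i<3. f i) = f 0 + f 1 + f (2::nat)" for f :: "nat \<Rightarrow> nat"
  by (simp add: numeral_3_eq_3 numeral_2_eq_2)

text \<open>Stated for a function of local coordinates, so that reversing or transposing a block is
  a substitution.\<close>

definition lines :: "(nat \<Rightarrow> nat \<Rightarrow> nat) \<Rightarrow> bool" where
  "lines x \<longleftrightarrow> (\<forall>i<3. (\<Sum>j<3. x i j) mod 9 = 0) \<and> (\<forall>j<3. (\<Sum>i<3. x i j) mod 9 = 0)
     \<and> (\<Sum>k<3. x k k) mod 9 = 0 \<and> (\<Sum>k<3. x k (2 - k)) mod 9 = 0"

lemma lines_iff: "lines x \<longleftrightarrow>
   (x 0 0 + x 0 1 + x 0 2) mod 9 = 0 \<and> (x 1 0 + x 1 1 + x 1 2) mod 9 = 0 \<and>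
   (x 2 0 + x 2 1 + x 2 2) mod 9 = 0 \<and> (x 0 0 + x 1 0 + x 2 0) mod 9 = 0 \<and>
   (x 0 1 + x 1 1 + x 2 1) mod 9 = 0 \<and> (x 0 2 + x 1 2 + x 2 2) mod 9 = 0 \<and>
   (x 0 0 + x 1 1 + x 2 2) mod 9 = 0 \<and> (x 0 2 + x 1 1 + x 2 0) mod 9 = 0"
  by (simp add: lines_def all_less_3 sum_less_3)

lemma lines_flip_rows: "lines x \<Longrightarrow> lines (\<lambda>i j. x (2 - i) j)"
  and lines_flip_cols: "lines x \<Longrightarrow> lines (\<lambda>i j. x i (2 - j))"
  and lines_transpose: "lines x \<Longrightarrow> lines (\<lambda>i j. x j i)"
  by (simp_all add: lines_iff ac_simps)

lemma lines_cong:
  assumes "\<And>i j. i < 3 \<Longrightarrow> j < 3 \<Longrightarrow> x i j = y i j"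
  shows "lines x \<longleftrightarrow> lines y"
  by (simp add: lines_iff assms)

lemma modmagic_iff: "modmagic b \<longleftrightarrow> sudoku b \<and> (\<forall>I<3. \<forall>J<3. lines (\<lambda>i j. b (3 * I + i, 3 * J + j)))"
  by (simp add: modmagic_def lines_def)

text \<open>The contravariant counterpart of \<open>act\<close>: coordinates are substituted instead
  of cells being moved. By \<open>act_cellmap\<close>, \<open>cellmap f g\<close> acts as the
  pullback along the inverses of \<open>f\<close> and \<open>g\<close>.\<close>

definition pull :: "(nat \<Rightarrow> nat) \<Rightarrow> (nat \<Rightarrow> nat) \<Rightarrow> (nat \<times> nat \<Rightarrow> nat) \<Rightarrow> nat \<times> nat \<Rightarrow> nat" where
  "pull f g b = (\<lambda>(r, c)\<in>Cells. b (f r, g c))"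

definition transposed :: "(nat \<times> nat \<Rightarrow> nat) \<Rightarrow> nat \<times> nat \<Rightarrow> nat" where
  "transposed b = (\<lambda>(r, c)\<in>Cells. b (c, r))"

lemma pull_apply [simp]: "r < 9 \<Longrightarrow> c < 9 \<Longrightarrow> pull f g b (r, c) = b (f r, g c)"
  by (simp add: pull_def)

lemma transposed_apply [simp]: "r < 9 \<Longrightarrow> c < 9 \<Longrightarrow> transposed b (r, c) = b (c, r)"
  by (simp add: transposed_def)

text \<open>A triple is mapped into a single triple by compatibility with \<open>div 3\<close>, and
  onto it by counting.\<close>

lemma wreath_segment:
  assumes f: "wreath f" and "I < 3"
  obtains I' where "I' < 3" "bij_betw f {3 * I ..< 3 * I + 3} {3 * I' ..< 3 * I' + 3}"
proof -
  define I' where "I' = f (3 * I) div 3"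
  have "I' < 3" unfolding I'_def by (intro div3_less wreath_less[OF f]) (use assms in simp)
  have sub: "f r \<in> {3 * I' ..< 3 * I' + 3}" if "r \<in> {3 * I ..< 3 * I + 3}" for r
  proof -
    have "r < 9" "3 * I < 9" "r div 3 = (3 * I) div 3" using that assms by auto
    then have "f r div 3 = I'" unfolding I'_def by (rule wreath_div[OF f])
    then show ?thesis by auto
  qed
  have inj: "inj_on f {3 * I ..< 3 * I + 3}"
    by (rule inj_on_subset[OF wreath_inj[OF f]]) (use assms in auto)
  have "f ` {3 * I ..< 3 * I + 3} = {3 * I' ..< 3 * I' + 3}"
    by (rule card_subset_eq) (use sub in \<open>auto simp: card_image[OF inj]\<close>)
  then have "bij_betw f {3 * I ..< 3 * I + 3} {3 * I' ..< 3 * I' + 3}"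
    using inj by (simp add: bij_betw_def)
  with \<open>I' < 3\<close> show thesis by (rule that)
qed

lemma board_mem: "b \<in> Cells \<rightarrow>\<^sub>E Syms \<Longrightarrow> r < 9 \<Longrightarrow> c < 9 \<Longrightarrow> b (r, c) \<in> Syms"
  by (rule PiE_mem[of b Cells "\<lambda>_. Syms"]) simp_all

lemma sudoku_pull:
  assumes f: "wreath f" and g: "wreath g" and b: "sudoku b"
  shows "sudoku (pull f g b)"
proof -
  have bd: "b \<in> Cells \<rightarrow>\<^sub>E Syms" using b by (simp add: sudoku_def is_board_def)
  have f9: "bij_betw f {0..<9} {0..<9}" and g9: "bij_betw g {0..<9} {0..<9}"
    using f g unfolding wreath_def by blast+
  have "pull f g b \<in> Cells \<rightarrow>\<^sub>E Syms"
    unfolding pull_def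
    using wreath_less[OF f] wreath_less[OF g] board_mem[OF bd] by (auto simp: restrict_PiE_iff Cells_def)
  moreover have "bij_betw (\<lambda>c. pull f g b (r, c)) {0..<9} Syms" if r: "r < 9" for r
  proof -
    have "bij_betw (\<lambda>c. b (f r, c)) {0..<9} Syms"
      using b wreath_less[OF f r] by (simp add: sudoku_def)
    then have "bij_betw ((\<lambda>c. b (f r, c)) \<circ> g) {0..<9} Syms"
      by (rule bij_betw_trans[OF g9])
    then show ?thesis by (rule bij_betw_cong[THEN iffD1, rotated]) (use r in auto)
  qed
  moreover have "bij_betw (\<lambda>r. pull f g b (r, c)) {0..<9} Syms" if c: "c < 9" for c
  proof -
    have "bij_betw (\<lambda>r. b (r, g c)) {0..<9} Syms"
      using b wreath_less[OF g c] by (simp add: sudoku_def)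
    then have "bij_betw ((\<lambda>r. b (r, g c)) \<circ> f) {0..<9} Syms"
      by (rule bij_betw_trans[OF f9])
    then show ?thesis by (rule bij_betw_cong[THEN iffD1, rotated]) (use c in auto)
  qed
  moreover have "bij_betw (pull f g b) (block I J) Syms" if IJ: "I < 3" "J < 3" for I J
  proof -
    obtain I' J' where I': "I' < 3" "J' < 3"
      and bij: "bij_betw f {3 * I ..< 3 * I + 3} {3 * I' ..< 3 * I' + 3}"
        "bij_betw g {3 * J ..< 3 * J + 3} {3 * J' ..< 3 * J' + 3}"
      using wreath_segment[OF f IJ(1)] wreath_segment[OF g IJ(2)] by metis
    have "bij_betw (map_prod f g) (block I J) (block I' J')"
      unfolding block_def by (rule bij_betw_map_prod[OF bij])
    moreover have "bij_betw b (block I' J') Syms" using b I' by (simp add: sudoku_def)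
    ultimately have "bij_betw (b \<circ> map_prod f g) (block I J) Syms" by (rule bij_betw_trans)
    then show ?thesis
      by (rule bij_betw_cong[THEN iffD1, rotated]) (use IJ in \<open>auto simp: block_def\<close>)
  qed
  ultimately show ?thesis by (simp add: sudoku_def is_board_def)
qed

lemma sudoku_transposed:
  assumes b: "sudoku b"
  shows "sudoku (transposed b)"
proof -
  have bd: "b \<in> Cells \<rightarrow>\<^sub>E Syms" using b by (simp add: sudoku_def is_board_def)
  have "transposed b \<in> Cells \<rightarrow>\<^sub>E Syms"
    unfolding transposed_def
    using board_mem[OF bd] by (auto simp: restrict_PiE_iff Cells_def)
  moreover have "bij_betw (\<lambda>c. transposed b (r, c)) {0..<9} Syms" if r: "r < 9" for r
  proof -
    have "bij_betw (\<lambda>c. b (c, r)) {0..<9} Syms" using b r by (simp add: sudoku_def)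
    then show ?thesis by (rule bij_betw_cong[THEN iffD1, rotated]) (use r in auto)
  qed
  moreover have "bij_betw (\<lambda>r. transposed b (r, c)) {0..<9} Syms" if c: "c < 9" for c
  proof -
    have "bij_betw (\<lambda>r. b (c, r)) {0..<9} Syms" using b c by (simp add: sudoku_def)
    then show ?thesis by (rule bij_betw_cong[THEN iffD1, rotated]) (use c in auto)
  qed
  moreover have "bij_betw (transposed b) (block I J) Syms" if IJ: "I < 3" "J < 3" for I J
  proof -
    have "bij_betw prod.swap (block I J) (block J I)"
      unfolding block_def by (simp add: bij_betw_def product_swap)
    moreover have "bij_betw b (block J I) Syms" using b IJ by (simp add: sudoku_def)
    ultimately have "bij_betw (b \<circ> prod.swap) (block I J) Syms" by (rule bij_betw_trans)
    then show ?thesis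
      by (rule bij_betw_cong[THEN iffD1, rotated]) (use IJ in \<open>auto simp: block_def\<close>)
  qed
  ultimately show ?thesis by (simp add: sudoku_def is_board_def)
qed

text \<open>Maps of the nine row indices that permute the bands and reverse the order of the rows in
  some of them: the ones that keep all lines of the blocks, diagonals included.\<close>

definition mm_map :: "(nat \<Rightarrow> nat) \<Rightarrow> bool" where
  "mm_map f \<longleftrightarrow> wreath f \<and> (\<forall>I<3. \<exists>I'<3. (\<forall>j<3. f (3 * I + j) = 3 * I' + j) \<or> (\<forall>j<3. f (3 * I + j) = 3 * I' + (2 - j)))"

text \<open>Each new block is an old block with its rows, its columns, both or neither reversed, and
  reversals only permute the eight lines.\<close>

lemma MM_pull:
  assumes f: "mm_map f" and g: "mm_map g" and b: "b \<in> MM"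
  shows "pull f g b \<in> MM"
proof -
  have "lines (\<lambda>i j. pull f g b (3 * I + i, 3 * J + j))" if IJ: "I < 3" "J < 3" for I J
  proof -
    obtain I' where I': "I' < 3" "(\<forall>j<3. f (3 * I + j) = 3 * I' + j) \<or> (\<forall>j<3. f (3 * I + j) = 3 * I' + (2 - j))"
      using f IJ unfolding mm_map_def by blast
    obtain J' where J': "J' < 3" "(\<forall>j<3. g (3 * J + j) = 3 * J' + j) \<or> (\<forall>j<3. g (3 * J + j) = 3 * J' + (2 - j))"
      using g IJ unfolding mm_map_def by blast
    define x where "x = (\<lambda>i j. b (3 * I' + i, 3 * J' + j))"
    have x: "lines x" using b I' J' by (simp add: x_def MM_def modmagic_iff)
    have eq: "pull f g b (3 * I + i, 3 * J + j) = b (f (3 * I + i), g (3 * J + j))" if "i < 3" "j < 3" for i j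
      using IJ that by simp
    from I'(2) J'(2) x lines_flip_rows[OF x] lines_flip_cols[OF x] lines_flip_cols[OF lines_flip_rows[OF x]]
    show ?thesis
      by (elim disjE) (simp_all add: x_def eq cong: lines_cong)
  qed
  then show ?thesis
    using sudoku_pull[of f g b] f g b by (simp add: MM_def modmagic_iff mm_map_def)
qed

lemma MM_transposed:
  assumes b: "b \<in> MM"
  shows "transposed b \<in> MM"
proof -
  have "lines (\<lambda>i j. transposed b (3 * I + i, 3 * J + j))" if IJ: "I < 3" "J < 3" for I J
  proof -
    have "lines (\<lambda>i j. b (3 * J + i, 3 * I + j))" using b IJ by (simp add: MM_def modmagic_iff)
    moreover have "transposed b (3 * I + i, 3 * J + j) = b (3 * J + j, 3 * I + i)" if "i < 3" "j < 3" for i j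
      using IJ that by simp
    ultimately show ?thesis using lines_transpose by (simp cong: lines_cong)
  qed
  then show ?thesis
    using sudoku_transposed[of b] b by (simp add: MM_def modmagic_iff)
qed

abbreviation "id_Syms \<equiv> (\<lambda>n\<in>Syms. n)"

lemma act_cellmap:
  assumes "wreath f" "wreath g" "wreath f'" "wreath g'" "b \<in> MM"
    and inv: "\<And>r. r < 9 \<Longrightarrow> f' (f r) = r" "\<And>r. r < 9 \<Longrightarrow> g' (g r) = r"
  shows "act (cellmap f g, id_Syms) b = pull f' g' b"
proof (rule act_eqI[OF cellmap_Bij[OF assms(1,2)]])
  show "pull f' g' b \<in> extensional Cells" by (simp add: pull_def)
  fix x assume x: "x \<in> Cells"
  then have "b x \<in> Syms" by (rule PiE_mem[OF MM_boards[OF assms(5)]])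
  with x show "pull f' g' b (cellmap f g x) = id_Syms (b x)"
    by (cases x) (simp add: cellmap_def wreath_less assms inv)
qed

lemma act_transp: "b \<in> MM \<Longrightarrow> act (transp, id_Syms) b = transposed b"
proof (rule act_eqI)
  show "transp \<in> Bij Cells" by (simp add: H9_gens_eq tcellmap_Bij wreath_id)
  show "transposed b \<in> extensional Cells" by (simp add: transposed_def)
  fix x assume b: "b \<in> MM" and x: "x \<in> Cells"
  then have "b x \<in> Syms" by (intro PiE_mem[OF MM_boards])
  with x show "transposed b (transp x) = id_Syms (b x)"
    by (cases x) (simp add: transp_def)
qed

lemma Hmm_cellmap:
  assumes "cellmap f g \<in> H9" "wreath f" "wreath g" "mm_map f'" "mm_map g'"
    and inv: "\<And>r. r < 9 \<Longrightarrow> f' (f r) = r" "\<And>r. r < 9 \<Longrightarrow> g' (g r) = r"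
  shows "cellmap f g \<in> Hmm"
proof -
  have "wreath f'" "wreath g'" using assms(4,5) unfolding mm_map_def by blast+
  with assms show ?thesis by (simp add: Hmm_def act_cellmap MM_pull)
qed

lemma H9_gens_H9: "H9_gens \<subseteq> H9"
  unfolding H9_def by (auto intro: generate.incl)

lemma transp_Hmm: "transp \<in> Hmm"
  using H9_gens_H9 by (simp add: Hmm_def act_transp MM_transposed H9_gens_def)

text \<open>Takes a set of triples because the alignment step decides separately for each band
  whether to reverse it.\<close>

definition flip :: "nat set \<Rightarrow> nat \<Rightarrow> nat" where
  "flip e r = (if r div 3 \<in> e then 3 * (r div 3) + (2 - r mod 3) else r)"

lemma flip_triple: "j < 3 \<Longrightarrow> flip e (3 * i + j) = (if i \<in> e then 3 * i + (2 - j) else 3 * i + j)"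
  by (simp add: flip_def)

lemma reversed_triple:
  assumes "m < (3 :: nat)"
  shows "(3 * q + (2 - m)) div 3 = q" "(3 * q + (2 - m)) mod 3 = 2 - m"
proof -
  have "2 - m < 3" by simp
  then show "(3 * q + (2 - m)) div 3 = q" "(3 * q + (2 - m)) mod 3 = 2 - m"
    by (simp_all only: div_mult_self4 mod_mult_self4 div_less mod_less)
qed

lemma flip_div [simp]: "flip e r div 3 = r div 3"
  using reversed_triple(1)[OF mod3_less] by (simp only: flip_def split: if_split) blast

lemma flip_flip [simp]: "flip e (flip e r) = r"
proof (cases "r div 3 \<in> e")
  case True
  then have "flip e (flip e r) = 3 * (r div 3) + (2 - (2 - r mod 3))"
    by (simp only: flip_def reversed_triple[OF mod3_less] if_True)
  then show ?thesis by presburger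
qed (simp add: flip_def)

lemma wreath_flip: "wreath (flip e)"
proof (rule wreathI)
  fix r r' :: nat assume r: "r < 9" "r' < 9"
  show "flip e r < 9" using flip_div[of e r] div3_less[OF r(1)] by linarith
  show "r = r'" if "flip e r = flip e r'" using that by (metis flip_flip)
  show "flip e r div 3 = flip e r' div 3" if "r div 3 = r' div 3" using that by simp
qed

lemma mm_map_flip: "mm_map (flip e)"
  unfolding mm_map_def
proof (intro conjI wreath_flip allI impI)
  fix I :: nat assume "I < 3"
  then show "\<exists>I'<3. (\<forall>j<3. flip e (3 * I + j) = 3 * I' + j) \<or> (\<forall>j<3. flip e (3 * I + j) = 3 * I' + (2 - j))"
    by (cases "I \<in> e") (auto simp: flip_triple)
qed

lemma bandf_triple: "j < 3 \<Longrightarrow> bandf \<sigma> (3 * i + j) = 3 * \<sigma> i + j"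
  by (simp add: bandf_def)

lemma mm_map_bandf:
  assumes "\<sigma> permutes {0..<3}" shows "mm_map (bandf \<sigma>)"
  unfolding mm_map_def
proof (intro conjI wreath_bandf assms allI impI)
  fix I :: nat assume "I < 3"
  then show "\<exists>I'<3. (\<forall>j<3. bandf \<sigma> (3 * I + j) = 3 * I' + j) \<or> (\<forall>j<3. bandf \<sigma> (3 * I + j) = 3 * I' + (2 - j))"
    using permutes3_less[OF assms] by (auto simp: bandf_triple)
qed

lemma mm_map_id: "mm_map id"
  by (auto simp: mm_map_def wreath_id)

lemma bandf_inv: "\<sigma> permutes {0..<3} \<Longrightarrow> bandf (inv_into UNIV \<sigma>) (bandf \<sigma> r) = r"
  by (simp add: bandf_def permutes_inverses)

text \<open>Swapping 0 and 2 is the reversal \<open>j\<close> to \<open>2 - j\<close> on a triple,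
  which is its own inverse.\<close>

lemma rowf_transpose: "k < 3 \<Longrightarrow> flip {k} (rowf k (Transposition.transpose 0 2) r) = r"
proof -
  have "r mod 3 = 0 \<or> r mod 3 = 1 \<or> r mod 3 = 2" by arith
  then show ?thesis
    by (auto simp: flip_def rowf_def transpose_def) presburger+
qed

lemma transpose_0_2: "Transposition.transpose 0 2 permutes {0..<3::nat}"
  by (rule permutes_swap_id) auto

lemma H9_memI:
  assumes "\<sigma> permutes {0..<3}"
  shows "cellmap (bandf \<sigma>) id \<in> H9" "cellmap id (bandf \<sigma>) \<in> H9"
    and "k < 3 \<Longrightarrow> cellmap (rowf k \<sigma>) id \<in> H9" "k < 3 \<Longrightarrow> cellmap id (rowf k \<sigma>) \<in> H9"
  by (rule subsetD[OF H9_gens_H9], use assms in \<open>auto simp: H9_gens_def H9_gens_eq[symmetric]\<close>)+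

lemma bandf_Hmm:
  assumes \<sigma>: "\<sigma> permutes {0..<3}"
  shows "cellmap (bandf \<sigma>) id \<in> Hmm" "cellmap id (bandf \<sigma>) \<in> Hmm"
proof -
  note maps = wreath_bandf[OF \<sigma>] wreath_id(1) mm_map_bandf[OF permutes_inv[OF \<sigma>]] mm_map_id
  show "cellmap (bandf \<sigma>) id \<in> Hmm"
    by (rule Hmm_cellmap[OF H9_memI(1)[OF \<sigma>] maps(1,2,3,4)]) (simp_all add: bandf_inv[OF \<sigma>])
  show "cellmap id (bandf \<sigma>) \<in> Hmm"
    by (rule Hmm_cellmap[OF H9_memI(2)[OF \<sigma>] maps(2,1,4,3)]) (simp_all add: bandf_inv[OF \<sigma>])
qed

abbreviation "reversal k \<equiv> rowf k (Transposition.transpose 0 2)"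

lemma reversal_Hmm:
  assumes k: "k < 3"
  shows "cellmap (reversal k) id \<in> Hmm" "cellmap id (reversal k) \<in> Hmm"
proof -
  note maps = wreath_rowf[OF transpose_0_2] wreath_id(1) mm_map_flip[of "{k}"] mm_map_id
  show "cellmap (reversal k) id \<in> Hmm"
    by (rule Hmm_cellmap[OF H9_memI(3)[OF transpose_0_2 k] maps(1,2,3,4)])
      (simp_all add: rowf_transpose[OF k])
  show "cellmap id (reversal k) \<in> Hmm"
    by (rule Hmm_cellmap[OF H9_memI(4)[OF transpose_0_2 k] maps(2,1,4,3)])
      (simp_all add: rowf_transpose[OF k])
qed

section \<open>Relabelings that preserve modular-magic boards\<close>

definition relabel :: "(nat \<Rightarrow> nat) \<Rightarrow> (nat \<times> nat \<Rightarrow> nat) \<Rightarrow> nat \<times> nat \<Rightarrow> nat" where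
  "relabel s b = (\<lambda>x\<in>Cells. s (b x))"

lemma relabel_apply [simp]: "r < 9 \<Longrightarrow> c < 9 \<Longrightarrow> relabel s b (r, c) = s (b (r, c))"
  by (simp add: relabel_def)

lemma act_relabel: "act (\<lambda>x\<in>Cells. x, s) b = relabel s b"
  by (rule act_eqI) (simp_all add: id_Bij relabel_def)

lemma act_split:
  assumes "h \<in> Bij Cells" "s \<in> Bij Syms" "b \<in> Cells \<rightarrow>\<^sub>E Syms"
  shows "act (h, s) b = relabel s (act (h, id_Syms) b)"
proof (rule act_eqI[OF assms(1)])
  show "relabel s (act (h, id_Syms) b) \<in> extensional Cells" by (simp add: relabel_def)
  fix x assume x: "x \<in> Cells"
  then show "relabel s (act (h, id_Syms) b) (h x) = s (b x)"
    using Bij_mem[OF assms(1) x] PiE_mem[OF assms(3) x]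
    by (simp add: relabel_def act_apply assms(1))
qed

definition magic :: "(nat \<Rightarrow> nat \<Rightarrow> nat) \<Rightarrow> bool" where
  "magic x \<longleftrightarrow> lines x \<and> (\<forall>i<3. \<forall>j<3. x i j < 9) \<and> inj_on (\<lambda>(i, j). x i j) ({0..<3} \<times> {0..<3})"

lemma MM_magic:
  assumes "b \<in> MM" "I < 3" "J < 3"
  shows "magic (\<lambda>i j. b (3 * I + i, 3 * J + j))"
proof -
  have bij: "bij_betw b (block I J) Syms"
    using assms by (simp add: MM_def modmagic_iff sudoku_def)
  have "inj_on (\<lambda>(i, j). b (3 * I + i, 3 * J + j)) ({0..<3} \<times> {0..<3})"
  proof (rule inj_onI, clarsimp)
    fix i j i' j' :: nat
    assume ij: "i < 3" "j < 3" "i' < 3" "j' < 3" "b (3 * I + i, 3 * J + j) = b (3 * I + i', 3 * J + j')"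
    then have "(3 * I + i, 3 * J + j) = (3 * I + i', 3 * J + j')"
      by (intro inj_onD[OF bij_betw_imp_inj_on[OF bij]]) (simp_all add: block_def)
    then show "i = i' \<and> j = j'" by simp
  qed
  moreover have "b (3 * I + i, 3 * J + j) < 9" if "i < 3" "j < 3" for i j
    using board_mem[OF MM_boards[OF assms(1)], of "3 * I + i" "3 * J + j"] that assms(2,3) by (simp add: Syms_def)
  ultimately show ?thesis
    using assms by (simp add: magic_def MM_def modmagic_iff)
qed

text \<open>The Sudoku conditions survive every permutation of symbols, so only the line sums
  remain. They are local to a block, which reduces the question to single magic blocks.\<close>

lemma MM_relabel:
  assumes b: "b \<in> MM" and s: "s \<in> Bij Syms" and mag: "\<And>x. magic x \<Longrightarrow> lines (\<lambda>i j. s (x i j))"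
  shows "relabel s b \<in> MM"
proof -
  have bij: "bij_betw s Syms Syms" by (rule Bij_bij_betw[OF s])
  have su: "sudoku b" and bd: "b \<in> Cells \<rightarrow>\<^sub>E Syms" using b MM_boards by (simp_all add: MM_def modmagic_iff)
  have "relabel s b \<in> Cells \<rightarrow>\<^sub>E Syms"
    using PiE_mem[OF bd] Bij_mem[OF s] by (simp add: relabel_def)
  moreover have "bij_betw (\<lambda>c. relabel s b (r, c)) {0..<9} Syms" if r: "r < 9" for r
  proof -
    have "bij_betw (\<lambda>c. b (r, c)) {0..<9} Syms" using su r by (simp add: sudoku_def)
    then have "bij_betw (s \<circ> (\<lambda>c. b (r, c))) {0..<9} Syms" by (rule bij_betw_trans[OF _ bij])
    then show ?thesis by (rule bij_betw_cong[THEN iffD1, rotated]) (use r in auto)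
  qed
  moreover have "bij_betw (\<lambda>r. relabel s b (r, c)) {0..<9} Syms" if c: "c < 9" for c
  proof -
    have "bij_betw (\<lambda>r. b (r, c)) {0..<9} Syms" using su c by (simp add: sudoku_def)
    then have "bij_betw (s \<circ> (\<lambda>r. b (r, c))) {0..<9} Syms" by (rule bij_betw_trans[OF _ bij])
    then show ?thesis by (rule bij_betw_cong[THEN iffD1, rotated]) (use c in auto)
  qed
  moreover have "bij_betw (relabel s b) (block I J) Syms" if IJ: "I < 3" "J < 3" for I J
  proof -
    have "bij_betw b (block I J) Syms" using su IJ by (simp add: sudoku_def)
    then have "bij_betw (s \<circ> b) (block I J) Syms" by (rule bij_betw_trans[OF _ bij])
    then show ?thesis
      by (rule bij_betw_cong[THEN iffD1, rotated]) (use IJ in \<open>auto simp: block_def\<close>)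
  qed
  moreover have "lines (\<lambda>i j. relabel s b (3 * I + i, 3 * J + j))" if IJ: "I < 3" "J < 3" for I J
  proof -
    have "relabel s b (3 * I + i, 3 * J + j) = s (b (3 * I + i, 3 * J + j))" if "i < 3" "j < 3" for i j
      using IJ that by simp
    then show ?thesis using mag[OF MM_magic[OF b IJ]] by (simp cong: lines_cong)
  qed
  ultimately show ?thesis by (simp add: MM_def modmagic_iff sudoku_def is_board_def)
qed

definition "MM_relabelings = {s \<in> Bij Syms. \<forall>b\<in>MM. relabel s b \<in> MM}"

lemma subgroup_MM_relabelings: "subgroup MM_relabelings (BijGroup Syms)"
proof (rule group.finite_subgroupI[OF group_BijGroup finite_BijGroup[OF finite_Syms]])
  show "MM_relabelings \<subseteq> carrier (BijGroup Syms)"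
    by (auto simp: carrier_BijGroup MM_relabelings_def)
  have "relabel id_Syms b = b" if "b \<in> MM" for b
    using act_one[OF MM_boards[OF that]] by (simp add: act_relabel[symmetric] SymProd_def one_BijGroup)
  then show "\<one>\<^bsub>BijGroup Syms\<^esub> \<in> MM_relabelings"
    by (simp add: MM_relabelings_def one_BijGroup id_Bij)
  show "x \<otimes>\<^bsub>BijGroup Syms\<^esub> y \<in> MM_relabelings" if "x \<in> MM_relabelings" "y \<in> MM_relabelings" for x y
  proof -
    have xy: "x \<in> Bij Syms" "y \<in> Bij Syms" using that by (simp_all add: MM_relabelings_def)
    have "relabel (compose Syms x y) b = relabel x (relabel y b)" if "b \<in> MM" for b
      using PiE_mem[OF MM_boards[OF that]] by (auto simp: relabel_def compose_eq fun_eq_iff)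
    then show ?thesis
      using that by (simp add: mult_BijGroup xy MM_relabelings_def compose_Bij)
  qed
qed

lemma Syms_eq: "Syms = {0, 1, 2, 3, 4, 5, 6, 7, 8}"
  by (auto simp: Syms_def)

lemma rho_Bij: "rho \<in> Bij Syms"
  by (rule BijI_finite[OF finite_Syms]) (auto simp: rho_def Syms_eq)

lemma mu_Bij:
  assumes "k \<in> {1, 2, 4, 5, 7, 8}" "l \<in> {0, 3, 6}"
  shows "mu k l \<in> Bij Syms"
proof (rule BijI_finite[OF finite_Syms])
  show "mu k l \<in> extensional Syms" by (simp add: mu_def)
  show "mu k l x \<in> Syms" if "x \<in> Syms" for x using that by (simp add: mu_def Syms_def)
  have "inj_on (\<lambda>n. (k * n + l) mod 9) Syms"
    using assms unfolding Syms_eq by (elim insertE emptyE) simp_all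
  then show "inj_on (mu k l) Syms" by (rule inj_on_cong[THEN iffD1, rotated]) (simp add: mu_def)
qed

lemma mod_sum_3: "(a mod 9 + b mod 9 + c mod 9) mod 9 = (a + b + c) mod (9::nat)"
  by (metis mod_add_eq mod_add_left_eq mod_add_right_eq)

text \<open>A line sum \<open>s\<close> becomes \<open>k * s + 3 * l\<close> modulo 9.\<close>

lemma lines_mu:
  assumes x: "magic x" and l: "9 dvd 3 * l"
  shows "lines (\<lambda>i j. mu k l (x i j))"
proof -
  have sum: "((k * a + l) mod 9 + (k * b + l) mod 9 + (k * c + l) mod 9) mod 9 = 0"
    if "(a + b + c) mod 9 = 0" for a b c
  proof -
    have "9 dvd k * (a + b + c) + 3 * l" using that l by auto
    moreover have "((k * a + l) mod 9 + (k * b + l) mod 9 + (k * c + l) mod 9) mod 9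
        = (k * (a + b + c) + 3 * l) mod 9"
      unfolding mod_sum_3 by (rule arg_cong[of _ _ "\<lambda>n. n mod 9"]) (simp add: algebra_simps)
    ultimately show ?thesis by simp
  qed
  have "mu k l (x i j) = (k * x i j + l) mod 9" if "i < 3" "j < 3" for i j
    using x that by (simp add: magic_def mu_def Syms_def)
  then show ?thesis
    using x by (simp add: magic_def lines_iff sum)
qed

subsection \<open>Modular-magic blocks\<close>

text \<open>The third entry of a line, namely -(a + b) modulo 9. As a + b is at most 16 for symbols,
  the constant 18 keeps the subtraction of naturals from being cut off.\<close>

definition compl :: "nat \<Rightarrow> nat \<Rightarrow> nat" where
  "compl a b = (18 - (a + b)) mod 9"

lemma compl:
  assumes "a < 9" "b < 9" "c < 9" "(a + b + c) mod 9 = 0"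
  shows "c = compl a b"
proof -
  obtain q where q: "a + b + c = 9 * q" using assms(4) by (auto elim: dvdE)
  then have "q < 3" using assms(1-3) by linarith
  then have "18 - (a + b) = c + 9 * (2 - q)" using q by linarith
  then show ?thesis using assms(3) by (simp only: compl_def mod_mult_self2 mod_less)
qed

text \<open>The list is the value table of \<open>rho\<close>, in a form suited to evaluation by
  \<open>code_simp\<close>.\<close>

definition rho_sum :: "nat \<Rightarrow> nat \<Rightarrow> nat \<Rightarrow> nat" where
  "rho_sum a b c = (let r = [0, 2, 1, 3, 5, 4, 6, 8, 7] in (r ! a + r ! b + r ! c) mod 9)"


text \<open>A block read row by row, with center \<open>e\<close>. Everything later drawn from the
  block search is collected here so that one computation proves it: the two opposite corners that
  carry the other multiples of 3, and the preservation of all eight line sums by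
  \<open>rho\<close>.\<close>

definition magic_facts :: "nat \<Rightarrow> nat \<Rightarrow> nat \<Rightarrow> nat \<Rightarrow> nat \<Rightarrow> nat \<Rightarrow> nat \<Rightarrow> nat \<Rightarrow> nat \<Rightarrow> bool" where
  "magic_facts a b c d e f g h i \<longleftrightarrow>
    (e = 0 \<or> e = 3 \<or> e = 6) \<and> b mod 3 \<noteq> 0 \<and> d mod 3 \<noteq> 0 \<and>
    (a = (e + 3) mod 9 \<and> i = (e + 6) mod 9 \<and> c mod 3 \<noteq> 0 \<and> g mod 3 \<noteq> 0 \<or>
     a = (e + 6) mod 9 \<and> i = (e + 3) mod 9 \<and> c mod 3 \<noteq> 0 \<and> g mod 3 \<noteq> 0 \<or>
     c = (e + 3) mod 9 \<and> g = (e + 6) mod 9 \<and> a mod 3 \<noteq> 0 \<and> i mod 3 \<noteq> 0 \<or>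
     c = (e + 6) mod 9 \<and> g = (e + 3) mod 9 \<and> a mod 3 \<noteq> 0 \<and> i mod 3 \<noteq> 0) \<and>
    rho_sum a b c = 0 \<and> rho_sum d e f = 0 \<and> rho_sum g h i = 0 \<and> rho_sum a d g = 0 \<and>
    rho_sum b e h = 0 \<and> rho_sum c f i = 0 \<and> rho_sum a e i = 0 \<and> rho_sum c e g = 0"

text \<open>The corner \<open>a\<close>, the entry \<open>b\<close> next to it and the center \<open>e\<close> determine a block. The search is split
  into stages taking evaluated arguments so that \<open>code_simp\<close> computes every entry only once.\<close>

definition block_ok_4 :: "nat \<Rightarrow> nat \<Rightarrow> nat \<Rightarrow> nat \<Rightarrow> nat \<Rightarrow> nat \<Rightarrow> nat \<Rightarrow> nat \<Rightarrow> nat \<Rightarrow> bool" where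
  "block_ok_4 a b c d e f g h i = (if distinct [a, b, c, d, e, f, g, h, i] then magic_facts a b c d e f g h i else True)"
definition block_ok_3 :: "nat \<Rightarrow> nat \<Rightarrow> nat \<Rightarrow> nat \<Rightarrow> nat \<Rightarrow> nat \<Rightarrow> nat \<Rightarrow> bool" where
  "block_ok_3 a b c e g h i = block_ok_4 a b c (compl a g) e (compl c i) g h i"
definition block_ok_2 :: "nat \<Rightarrow> nat \<Rightarrow> nat \<Rightarrow> nat \<Rightarrow> nat \<Rightarrow> nat \<Rightarrow> bool" where
  "block_ok_2 a b c e h i = (if distinct [a, b, c, e, h, i] then block_ok_3 a b c e (compl c e) h i else True)"
definition block_ok_1 :: "nat \<Rightarrow> nat \<Rightarrow> nat \<Rightarrow> bool" where
  "block_ok_1 a b e = block_ok_2 a b (compl a b) e (compl b e) (compl a e)"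

definition "digits = [0, 1, 2, 3, 4, 5, 6, 7, 8 :: nat]"

lemma magic_check: "\<forall>e\<in>set [0, 3, 6]. \<forall>a\<in>set digits. \<forall>b\<in>set digits. block_ok_1 a b e"
  by code_simp

text \<open>The four lines through the center cover it four times and every other cell once, while
  the three rows cover each cell once. The difference of the two sums is three times the center, so
  9 divides that.\<close>

lemma magic_center:
  assumes "magic x"
  shows "x 1 1 = 0 \<or> x 1 1 = 3 \<or> x 1 1 = 6"
proof -
  have l: "9 dvd x 0 0 + x 0 1 + x 0 2" "9 dvd x 1 0 + x 1 1 + x 1 2" "9 dvd x 2 0 + x 2 1 + x 2 2"
    "9 dvd x 0 1 + x 1 1 + x 2 1" "9 dvd x 0 0 + x 1 1 + x 2 2" "9 dvd x 0 2 + x 1 1 + x 2 0"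
    using assms by (simp_all add: magic_def lines_iff mod_eq_0_iff_dvd)
  have "9 dvd (x 0 0 + x 0 1 + x 0 2) + (x 1 0 + x 1 1 + x 1 2) + (x 2 0 + x 2 1 + x 2 2)"
    by (intro dvd_add l)
  moreover have "9 dvd (x 1 0 + x 1 1 + x 1 2) + (x 0 1 + x 1 1 + x 2 1) + (x 0 0 + x 1 1 + x 2 2) + (x 0 2 + x 1 1 + x 2 0)"
    by (intro dvd_add l)
  moreover have "(x 1 0 + x 1 1 + x 1 2) + (x 0 1 + x 1 1 + x 2 1) + (x 0 0 + x 1 1 + x 2 2) + (x 0 2 + x 1 1 + x 2 0)
    = ((x 0 0 + x 0 1 + x 0 2) + (x 1 0 + x 1 1 + x 1 2) + (x 2 0 + x 2 1 + x 2 2)) + 3 * x 1 1"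
    by simp
  ultimately have "9 dvd 3 * x 1 1" by (metis dvd_add_right_iff)
  then have "3 dvd x 1 1" by (simp add: dvd_mult_cancel_left[of 3 3, simplified])
  moreover have "x 1 1 < 9" using assms by (simp add: magic_def)
  ultimately show ?thesis by presburger
qed

lemma less_9_digits: "n < 9 \<Longrightarrow> n \<in> set digits"
  by (auto simp: digits_def)

lemma magic_distinct:
  assumes "magic x"
  shows "distinct [x 0 0, x 0 1, x 0 2, x 1 0, x 1 1, x 1 2, x 2 0, x 2 1, x 2 2]"
proof -
  define cs :: "(nat \<times> nat) list" where "cs = [(0,0), (0,1), (0,2), (1,0), (1,1), (1,2), (2,0), (2,1), (2,2)]"
  have "inj_on (\<lambda>(i, j). x i j) (set cs)"
    by (rule inj_on_subset[of _ "{0..<3} \<times> {0..<3}"]) (use assms in \<open>auto simp: magic_def cs_def\<close>)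
  then have "distinct (map (\<lambda>(i, j). x i j) cs)" by (simp add: distinct_map cs_def)
  then show ?thesis by (simp only: cs_def list.map prod.case)
qed

lemma magic_compl:
  assumes x: "magic x"
  shows "x 0 2 = compl (x 0 0) (x 0 1)" "x 2 2 = compl (x 0 0) (x 1 1)" "x 2 1 = compl (x 0 1) (x 1 1)"
    "x 2 0 = compl (x 0 2) (x 1 1)" "x 1 0 = compl (x 0 0) (x 2 0)" "x 1 2 = compl (x 0 2) (x 2 2)"
proof -
  have "lines x" and less: "\<And>i j. i < 3 \<Longrightarrow> j < 3 \<Longrightarrow> x i j < 9"
    using x by (simp_all add: magic_def)
  then show "x 0 2 = compl (x 0 0) (x 0 1)" "x 2 2 = compl (x 0 0) (x 1 1)" "x 2 1 = compl (x 0 1) (x 1 1)"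
    "x 2 0 = compl (x 0 2) (x 1 1)" "x 1 0 = compl (x 0 0) (x 2 0)" "x 1 2 = compl (x 0 2) (x 2 2)"
    by (auto intro!: compl less simp: lines_iff ac_simps)
qed

lemma magic_factsI:
  assumes x: "magic x"
  shows "magic_facts (x 0 0) (x 0 1) (x 0 2) (x 1 0) (x 1 1) (x 1 2) (x 2 0) (x 2 1) (x 2 2)"
proof -
  have less: "x i j < 9" if "i < 3" "j < 3" for i j
    using x that by (simp add: magic_def)
  have "block_ok_1 (x 0 0) (x 0 1) (x 1 1)"
    using magic_check magic_center[OF x] less_9_digits[OF less[of 0 0]] less_9_digits[OF less[of 0 1]]
    by auto
  moreover have "distinct [x 0 0, x 0 1, x 0 2, x 1 1, x 2 1, x 2 2]"
    using magic_distinct[OF x] by auto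
  ultimately show ?thesis
    using magic_distinct[OF x]
    unfolding block_ok_1_def block_ok_2_def block_ok_3_def block_ok_4_def magic_compl(1-3)[OF x, symmetric]
    by (simp only: if_True magic_compl(4-6)[OF x, symmetric])
qed

lemma rho_nth: "n < 9 \<Longrightarrow> rho n = [0, 2, 1, 3, 5, 4, 6, 8, 7] ! n"
  using less_9_digits[of n] by (auto simp: digits_def rho_def Syms_def)

lemma rho_sum: "a < 9 \<Longrightarrow> b < 9 \<Longrightarrow> c < 9 \<Longrightarrow> rho_sum a b c = (rho a + rho b + rho c) mod 9"
  by (simp only: rho_sum_def rho_nth Let_def)

text \<open>The map \<open>rho\<close> is not affine, yet it keeps the sums. Three distinct symbols
  with sum 0 modulo 9 have residues 0, 1, 2 modulo 3 or are all multiples of 3, since 1 + 4 + 7 and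
  2 + 5 + 8 are not divisible by 9. So \<open>rho\<close> raises one entry by 1 and lowers another
  by 1, or fixes all three. The formal proof takes this from the computed
  \<open>magic_facts\<close>.\<close>

lemma lines_rho:
  assumes x: "magic x"
  shows "lines (\<lambda>i j. rho (x i j))"
proof -
  have less: "x i j < 9" if "i < 3" "j < 3" for i j
    using x that by (simp add: magic_def)
  show ?thesis
    using magic_factsI[OF x] unfolding magic_facts_def
    by (simp add: lines_iff less rho_sum)
qed

lemma Smm_gens_Bij: "{rho} \<union> {mu k l | k l. k \<in> {1, 2, 4, 5, 7, 8} \<and> l \<in> {0, 3, 6}} \<subseteq> Bij Syms"
  using rho_Bij mu_Bij by blast

lemma Smm_MM: "Smm \<subseteq> MM_relabelings"
  unfolding Smm_def
proof (rule group.generate_subgroup_incl[OF group_BijGroup _ subgroup_MM_relabelings])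
  have "rho \<in> MM_relabelings"
    using rho_Bij by (simp add: MM_relabelings_def MM_relabel lines_rho)
  moreover have "mu k l \<in> MM_relabelings" if "k \<in> {1, 2, 4, 5, 7, 8}" "l \<in> {0, 3, 6}" for k l
  proof -
    have "9 dvd 3 * l" using that(2) by auto
    then show ?thesis using mu_Bij[OF that] lines_mu by (simp add: MM_relabelings_def MM_relabel)
  qed
  ultimately show "{rho} \<union> {mu k l | k l. k \<in> {1, 2, 4, 5, 7, 8} \<and> l \<in> {0, 3, 6}} \<subseteq> MM_relabelings"
    by blast
qed

lemma subgroup_Smm: "subgroup Smm (BijGroup Syms)"
  unfolding Smm_def
  by (rule group.generate_is_subgroup[OF group_BijGroup]) (use Smm_gens_Bij in \<open>simp add: carrier_BijGroup\<close>)

abbreviation "S0 \<equiv> generate (BijGroup Syms) {rho, mu 4 0}"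

lemma subgroup_S0: "subgroup S0 (BijGroup Syms)"
  by (rule group.generate_is_subgroup[OF group_BijGroup]) (simp add: carrier_BijGroup rho_Bij mu_Bij)

lemma S0_Smm: "S0 \<subseteq> Smm"
  unfolding Smm_def by (rule group.mono_generate[OF group_BijGroup]) auto

lemma subgroup_K0: "subgroup K0 SymProd" and subgroup_Gmm: "subgroup Gmm SymProd"
  unfolding K0_def Gmm_def SymProd_def
  by (simp_all add: DirProd_subgroups group_BijGroup subgroup_Hmm subgroup_S0 subgroup_Smm)

lemma K0_Gmm: "K0 \<subseteq> Gmm"
  using S0_Smm by (auto simp: K0_def Gmm_def)

section \<open>The action on modular-magic boards\<close>

lemma act_MM:
  assumes "g \<in> Gmm" "b \<in> MM"
  shows "act g b \<in> MM"
proof -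
  obtain h s where g: "g = (h, s)" "h \<in> Hmm" "s \<in> Smm" using assms by (auto simp: Gmm_def)
  have "s \<in> Bij Syms" "act (h, id_Syms) b \<in> MM"
    using g assms Smm_MM by (auto simp: Hmm_def MM_relabelings_def)
  moreover have "h \<in> Bij Cells" using g Hmm_sub H9_Bij by auto
  ultimately show ?thesis
    using g(3) Smm_MM assms(2) by (auto simp: g(1) act_split MM_boards MM_relabelings_def)
qed

text \<open>Membership of both boards in \<open>MM\<close> is bundled with the orbit relation, so
  that chains of normalization steps compose without side conditions.\<close>

definition reach :: "(nat \<times> nat \<Rightarrow> nat) \<Rightarrow> (nat \<times> nat \<Rightarrow> nat) \<Rightarrow> bool" where
  "reach b b' \<longleftrightarrow> b \<in> MM \<and> b' \<in> MM \<and> b' \<in> orbit K0 b"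

lemma reachI: "b \<in> MM \<Longrightarrow> g \<in> K0 \<Longrightarrow> act g b = b' \<Longrightarrow> reach b b'"
  using act_MM[of g b] K0_Gmm orbitI[of g K0 b b'] by (auto simp: reach_def)

lemma reach_trans: "reach b b' \<Longrightarrow> reach b' b'' \<Longrightarrow> reach b b''"
  unfolding reach_def using orbit_trans[OF subgroup_K0] MM_boards by blast

lemma reach_sym: "reach b b' \<Longrightarrow> reach b' b"
  unfolding reach_def using orbit_sym[OF subgroup_K0] MM_boards by blast

lemma reach_refl: "b \<in> MM \<Longrightarrow> reach b b"
  unfolding reach_def using orbit_refl[OF subgroup_K0] MM_boards by blast

lemma Hmm_K0: "h \<in> Hmm \<Longrightarrow> (h, id_Syms) \<in> K0"
  using subgroup.one_closed[OF subgroup_S0] by (simp add: K0_def one_BijGroup)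

lemma S0_K0: "s \<in> S0 \<Longrightarrow> (\<lambda>x\<in>Cells. x, s) \<in> K0"
  using subgroup.one_closed[OF subgroup_Hmm] by (simp add: K0_def one_BijGroup)

lemma reach_relabel: "b \<in> MM \<Longrightarrow> s \<in> S0 \<Longrightarrow> reach b (relabel s b)"
  by (rule reachI[OF _ S0_K0 act_relabel])

lemma reach_transposed: "b \<in> MM \<Longrightarrow> reach b (transposed b)"
  by (rule reachI[OF _ Hmm_K0[OF transp_Hmm] act_transp])

lemma reach_bands:
  assumes b: "b \<in> MM" and \<sigma>: "\<sigma> permutes {0..<3}"
  shows "reach b (pull (bandf \<sigma>) id b)" "reach b (pull id (bandf \<sigma>) b)"
proof -
  \<comment> \<open>Moving cells by a map pulls the board back along its inverse, so the group
    element for the pullback along \<sigma> is built from \<tau>.\<close>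
  define \<tau> where "\<tau> = inv_into UNIV \<sigma>"
  have \<tau>: "\<tau> permutes {0..<3}" and \<sigma>\<tau>: "bandf \<sigma> (bandf \<tau> r) = r" for r
    using permutes_inv[OF \<sigma>] bandf_inv[OF permutes_inv[OF \<sigma>]] permutes_inv_inv[OF \<sigma>] by (simp_all add: \<tau>_def)
  note maps = wreath_bandf[OF \<tau>] wreath_id(1) wreath_bandf[OF \<sigma>]
  show "reach b (pull (bandf \<sigma>) id b)"
    by (rule reachI[OF b Hmm_K0[OF bandf_Hmm(1)[OF \<tau>]]], rule act_cellmap)
      (simp_all add: maps b \<sigma>\<tau> wreath_id)
  show "reach b (pull id (bandf \<sigma>) b)"
    by (rule reachI[OF b Hmm_K0[OF bandf_Hmm(2)[OF \<tau>]]], rule act_cellmap)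
      (simp_all add: maps b \<sigma>\<tau> wreath_id)
qed

lemma reach_flip_single:
  assumes b: "b \<in> MM" and k: "k < 3"
  shows "reach b (pull (flip {k}) id b)" "reach b (pull id (flip {k}) b)"
proof -
  show "reach b (pull (flip {k}) id b)"
    by (rule reachI[OF b Hmm_K0[OF reversal_Hmm(1)[OF k]]], rule act_cellmap)
      (simp_all add: b wreath_id wreath_flip wreath_rowf transpose_0_2 rowf_transpose[OF k])
  show "reach b (pull id (flip {k}) b)"
    by (rule reachI[OF b Hmm_K0[OF reversal_Hmm(2)[OF k]]], rule act_cellmap)
      (simp_all add: b wreath_id wreath_flip wreath_rowf transpose_0_2 rowf_transpose[OF k])
qed

lemma pull_pull:
  assumes "wreath f" "wreath g"
  shows "pull f g (pull f' g' b) = pull (\<lambda>r. f' (f r)) (\<lambda>r. g' (g r)) b"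
  using assms by (auto simp: pull_def wreath_less fun_eq_iff)

lemma flip_insert: "k \<notin> e \<Longrightarrow> flip e (flip {k} r) = flip (insert k e) r"
proof (cases "r div 3 = k")
  case True
  then show "k \<notin> e \<Longrightarrow> flip e (flip {k} r) = flip (insert k e) r"
    using flip_div[of "{k}" r] by (simp add: flip_def[of e "flip {k} r"]) (simp add: flip_def)
qed (simp add: flip_def)

lemma reach_flip:
  assumes b: "b \<in> MM" and e: "e \<subseteq> {0..<3}"
  shows "reach b (pull (flip e) id b)" "reach b (pull id (flip e) b)"
proof -
  have "finite e" using e finite_subset by blast
  then have "e \<subseteq> {0..<3} \<longrightarrow> reach b (pull (flip e) id b) \<and> reach b (pull id (flip e) b)"
  proof (induction e)
    case empty
    have "flip {} = id" by (auto simp: flip_def)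
    moreover have "pull id id b = b"
      using MM_boards[OF b] by (auto simp: pull_def fun_eq_iff PiE_def extensional_def Cells_def)
    ultimately show ?case using reach_refl[OF b] by metis
  next
    case (insert k e)
    show ?case
    proof
      assume "insert k e \<subseteq> {0..<3}"
      then have k: "k < 3" and sub: "e \<subseteq> {0..<3}" by simp_all
      have r: "reach b (pull (flip e) id b)" "reach b (pull id (flip e) b)"
        using insert.IH sub by blast+
      from r have m: "pull (flip e) id b \<in> MM" "pull id (flip e) b \<in> MM" by (auto simp: reach_def)
      have "pull (flip {k}) id (pull (flip e) id b) = pull (flip (insert k e)) id b"
        "pull id (flip {k}) (pull id (flip e) b) = pull id (flip (insert k e)) b"
        using insert.hyps(2) by (simp_all add: pull_pull wreath_flip wreath_id flip_insert id_def)
      then show "reach b (pull (flip (insert k e)) id b) \<and> reach b (pull id (flip (insert k e)) b)"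
        using reach_flip_single(1)[OF m(1) k] reach_flip_single(2)[OF m(2) k] r reach_trans by metis
    qed
  qed
  with e show "reach b (pull (flip e) id b)" "reach b (pull id (flip e) b)" by fast+
qed

subsection \<open>Normal form of a modular-magic board\<close>

text \<open>The fixed Latin square is the addition table of the integers modulo 3, scaled by 3. Its
  symmetry lets it survive transposition.\<close>

definition centered :: "(nat \<times> nat \<Rightarrow> nat) \<Rightarrow> bool" where
  "centered b \<longleftrightarrow> (\<forall>i<3. \<forall>j<3. b (3 * i + 1, 3 * j + 1) = 3 * ((i + j) mod 3))"

lemma sort_triple:
  fixes t :: "nat \<Rightarrow> nat"
  assumes "\<And>j. j < 3 \<Longrightarrow> t j = 0 \<or> t j = 3 \<or> t j = 6" "inj_on t {0..<3}"
  obtains \<sigma> where "\<sigma> permutes {0..<3}" "\<And>j. j < 3 \<Longrightarrow> t (\<sigma> j) = 3 * j"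
proof -
  have t3: "t j = 3 * (t j div 3)" "t j div 3 < 3" if "j < 3" for j
    using assms(1)[OF that] by auto
  have "inj_on (\<lambda>j. t j div 3) {0..<3}"
    by (rule inj_onI) (metis assms(2) atLeastLessThan_iff inj_onD t3(1))
  moreover have "(\<lambda>j. t j div 3) ` {0..<3} \<subseteq> {0..<3}" using t3(2) by auto
  ultimately have bij: "bij_betw (\<lambda>j. t j div 3) {0..<3} {0..<3}"
    by (simp add: bij_betw_def endo_inj_surj)
  define \<sigma> where "\<sigma> = (\<lambda>j. if j < 3 then inv_into {0..<3} (\<lambda>j. t j div 3) j else j)"
  have "bij_betw \<sigma> {0..<3} {0..<3}"
    by (rule bij_betw_cong[THEN iffD1, OF _ bij_betw_inv_into[OF bij]]) (simp add: \<sigma>_def)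
  then have "\<sigma> permutes {0..<3}"
    by (rule bij_imp_permutes) (simp add: \<sigma>_def)
  moreover have "t (\<sigma> j) = 3 * j" if "j < 3" for j
  proof -
    have "\<sigma> j < 3" "t (\<sigma> j) div 3 = j"
      using that bij_betw_inv_into_right[OF bij, of j] inv_into_into[of j "\<lambda>j. t j div 3" "{0..<3}"] bij
      by (auto simp: \<sigma>_def bij_betw_def)
    then show ?thesis using t3(1)[of "\<sigma> j"] by simp
  qed
  ultimately show thesis by (rule that)
qed

lemma MM_center:
  assumes "b \<in> MM" "i < 3" "j < 3"
  shows "b (3 * i + 1, 3 * j + 1) = 0 \<or> b (3 * i + 1, 3 * j + 1) = 3 \<or> b (3 * i + 1, 3 * j + 1) = 6"
  by (rule magic_center[OF MM_magic[OF assms]])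

lemma MM_row_eq: "b \<in> MM \<Longrightarrow> r < 9 \<Longrightarrow> c < 9 \<Longrightarrow> c' < 9 \<Longrightarrow> b (r, c) = b (r, c') \<longleftrightarrow> c = c'"
  and MM_col_eq: "b \<in> MM \<Longrightarrow> r < 9 \<Longrightarrow> r' < 9 \<Longrightarrow> c < 9 \<Longrightarrow> b (r, c) = b (r', c) \<longleftrightarrow> r = r'"
proof -
  assume b: "b \<in> MM"
  then have s: "sudoku b" by (simp add: MM_def modmagic_iff)
  show "b (r, c) = b (r, c') \<longleftrightarrow> c = c'" if "r < 9" "c < 9" "c' < 9"
  proof -
    have "inj_on (\<lambda>c. b (r, c)) {0..<9}"
      using s that(1) unfolding sudoku_def by (blast intro: bij_betw_imp_inj_on)
    then show ?thesis using that by (auto dest: inj_onD)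
  qed
  show "b (r, c) = b (r', c) \<longleftrightarrow> r = r'" if "r < 9" "r' < 9" "c < 9"
  proof -
    have "inj_on (\<lambda>r. b (r, c)) {0..<9}"
      using s that(3) unfolding sudoku_def by (blast intro: bij_betw_imp_inj_on)
    then show ?thesis using that by (auto dest: inj_onD)
  qed
qed

text \<open>Centers in a band share a board row and centers in a pillar share a board column, so the
  nine centers form a Latin square on 0, 3, 6. Sorting pillars by the top band and then bands by the
  left pillar fixes its first row and column, and these determine a Latin square of order 3.\<close>

lemma ex_centered:
  assumes b: "b \<in> MM"
  shows "\<exists>b'. reach b b' \<and> centered b'"
proof -
  have "inj_on (\<lambda>j. b (1, 3 * j + 1)) {0..<3}"
    by (rule inj_onI) (use MM_row_eq[OF b, of 1] in auto)
  then obtain \<sigma> where \<sigma>: "\<sigma> permutes {0..<3}" "\<And>j. j < 3 \<Longrightarrow> b (1, 3 * \<sigma> j + 1) = 3 * j"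
    using sort_triple[of "\<lambda>j. b (1, 3 * j + 1)"] MM_center[OF b, of 0] by auto
  define b1 where "b1 = pull id (bandf \<sigma>) b"
  have r1: "reach b b1" unfolding b1_def by (rule reach_bands[OF b \<sigma>(1)])
  then have b1: "b1 \<in> MM" by (simp add: reach_def)
  have top1: "b1 (1, 3 * j + 1) = 3 * j" if "j < 3" for j
    using \<sigma>(2)[OF that] that by (simp add: b1_def bandf_triple[of 1, simplified])
  have "inj_on (\<lambda>i. b1 (3 * i + 1, 1)) {0..<3}"
    by (rule inj_onI) (use MM_col_eq[OF b1, of _ _ 1] in auto)
  then obtain \<tau> where \<tau>: "\<tau> permutes {0..<3}" "\<And>i. i < 3 \<Longrightarrow> b1 (3 * \<tau> i + 1, 1) = 3 * i"
    using sort_triple[of "\<lambda>i. b1 (3 * i + 1, 1)"] MM_center[OF b1, of _ 0] by auto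
  define b2 where "b2 = pull (bandf \<tau>) id b1"
  have r2: "reach b1 b2" unfolding b2_def by (rule reach_bands[OF b1 \<tau>(1)])
  then have b2: "b2 \<in> MM" by (simp add: reach_def)
  have e: "b2 (3 * i + 1, 3 * j + 1) = b1 (3 * \<tau> i + 1, 3 * j + 1)" if "i < 3" "j < 3" for i j
    using that by (simp add: b2_def bandf_triple[of 1, simplified])
  have left: "b2 (3 * i + 1, 1) = 3 * i" if "i < 3" for i
    using e[of i 0] \<tau>(2) that by simp
  \<comment> \<open>Sorting the bands must not disturb the top band already sorted: it has center 0
    in the first pillar, and 0 occurs only once in column 1.\<close>
  have "b1 (3 * \<tau> 0 + 1, 1) = b1 (1, 1)" using \<tau>(2)[of 0] top1[of 0] by simp
  moreover have "\<tau> 0 < 3" using permutes3_less[OF \<tau>(1)] by simp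
  ultimately have "\<tau> 0 = 0" using MM_col_eq[OF b1, of "3 * \<tau> 0 + 1" 1 1] by simp
  then have top: "b2 (1, 3 * j + 1) = 3 * j" if "j < 3" for j
    using e[of 0 j] top1 that by simp
  have "b2 (1, 1) = 0" "b2 (1, 4) = 3" "b2 (1, 7) = 6" "b2 (4, 1) = 3" "b2 (7, 1) = 6"
    using top[of 0] top[of 1] top[of 2] left[of 1] left[of 2] by simp_all
  moreover have "b2 (4, 4) = 0 \<or> b2 (4, 4) = 3 \<or> b2 (4, 4) = 6" "b2 (4, 7) = 0 \<or> b2 (4, 7) = 3 \<or> b2 (4, 7) = 6"
    "b2 (7, 4) = 0 \<or> b2 (7, 4) = 3 \<or> b2 (7, 4) = 6" "b2 (7, 7) = 0 \<or> b2 (7, 7) = 3 \<or> b2 (7, 7) = 6"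
    using MM_center[OF b2, of 1 1] MM_center[OF b2, of 1 2] MM_center[OF b2, of 2 1] MM_center[OF b2, of 2 2]
    by simp_all
  moreover have "b2 (4, 1) \<noteq> b2 (4, 4)" "b2 (4, 1) \<noteq> b2 (4, 7)" "b2 (4, 4) \<noteq> b2 (4, 7)"
    "b2 (7, 1) \<noteq> b2 (7, 4)" "b2 (7, 1) \<noteq> b2 (7, 7)" "b2 (7, 4) \<noteq> b2 (7, 7)"
    "b2 (1, 4) \<noteq> b2 (4, 4)" "b2 (1, 4) \<noteq> b2 (7, 4)" "b2 (4, 4) \<noteq> b2 (7, 4)"
    "b2 (1, 7) \<noteq> b2 (4, 7)" "b2 (1, 7) \<noteq> b2 (7, 7)" "b2 (4, 7) \<noteq> b2 (7, 7)"
    by (simp_all add: MM_row_eq[OF b2] MM_col_eq[OF b2])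
  ultimately have "b2 (1, 1) = 0 \<and> b2 (1, 4) = 3 \<and> b2 (1, 7) = 6 \<and> b2 (4, 1) = 3 \<and> b2 (4, 4) = 6 \<and> b2 (4, 7) = 0 \<and>
    b2 (7, 1) = 6 \<and> b2 (7, 4) = 0 \<and> b2 (7, 7) = 3"
    by auto
  then have "centered b2" by (simp add: centered_def all_less_3)
  then show ?thesis using reach_trans[OF r1 r2] by blast
qed

text \<open>The value is the center plus 3 modulo 9, to be found in one of the two top corners. The
  column version asks for one of the two left corners, so both together force the top left
  corner.\<close>

definition rows_aligned :: "(nat \<times> nat \<Rightarrow> nat) \<Rightarrow> bool" where
  "rows_aligned b \<longleftrightarrow> (\<forall>i<3. \<forall>j<3. (3 * (i + j) + 3) mod 9 \<in> {b (3 * i, 3 * j), b (3 * i, 3 * j + 2)})"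

definition cols_aligned :: "(nat \<times> nat \<Rightarrow> nat) \<Rightarrow> bool" where
  "cols_aligned b \<longleftrightarrow> (\<forall>i<3. \<forall>j<3. (3 * (i + j) + 3) mod 9 \<in> {b (3 * i, 3 * j), b (3 * i + 2, 3 * j)})"

lemma magic_corners:
  assumes "magic x"
  shows "(x 1 1 + 3) mod 9 \<in> {x 0 0, x 0 2} \<and> (x 1 1 + 6) mod 9 \<in> {x 2 0, x 2 2} \<or>
    (x 1 1 + 6) mod 9 \<in> {x 0 0, x 0 2} \<and> (x 1 1 + 3) mod 9 \<in> {x 2 0, x 2 2}"
proof -
  have "x 0 0 = (x 1 1 + 3) mod 9 \<and> x 2 2 = (x 1 1 + 6) mod 9 \<or> x 0 0 = (x 1 1 + 6) mod 9 \<and> x 2 2 = (x 1 1 + 3) mod 9 \<or>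
      x 0 2 = (x 1 1 + 3) mod 9 \<and> x 2 0 = (x 1 1 + 6) mod 9 \<or> x 0 2 = (x 1 1 + 6) mod 9 \<and> x 2 0 = (x 1 1 + 3) mod 9"
    using magic_factsI[OF assms] unfolding magic_facts_def by blast
  then show ?thesis by (elim disjE conjE) (simp_all only: insert_iff simp_thms)
qed

text \<open>The block in the first pillar decides whether its band is reversed, and the row rule
  then forces the other two blocks of the band. Reversing rows swaps the two left corners of a
  block, so column alignment is kept.\<close>

lemma ex_rows_aligned:
  assumes b: "b \<in> MM" and c: "centered b"
  shows "\<exists>b'. reach b b' \<and> centered b' \<and> rows_aligned b' \<and> (cols_aligned b \<longrightarrow> cols_aligned b')"
proof -
  \<comment> \<open>The bands whose leftmost block has its center plus 3 in the bottom row.\<close>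
  define E where "E = {i. i < 3 \<and> (3 * i + 3) mod 9 \<notin> {b (3 * i, 0), b (3 * i, 2)}}"
  define b' where "b' = pull (flip E) id b"
  have "E \<subseteq> {0..<3}" by (auto simp: E_def)
  then have r: "reach b b'" unfolding b'_def by (rule reach_flip[OF b])
  then have b': "b' \<in> MM" by (simp add: reach_def)
  have b'_eq: "b' (3 * i + p, k) = b (if i \<in> E then 3 * i + (2 - p) else 3 * i + p, k)"
    if "i < 3" "p < 3" "k < 9" for i p k
    using that by (simp add: b'_def flip_triple)
  have c': "centered b'"
    unfolding centered_def
  proof (intro allI impI)
    fix i j :: nat assume ij: "i < 3" "j < 3"
    then have "b' (3 * i + 1, 3 * j + 1) = b (3 * i + 1, 3 * j + 1)"
      using b'_eq[OF ij(1), of 1 "3 * j + 1"] by (cases "i \<in> E") simp_all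
    also have "\<dots> = 3 * ((i + j) mod 3)" using c ij unfolding centered_def by blast
    finally show "b' (3 * i + 1, 3 * j + 1) = 3 * ((i + j) mod 3)" .
  qed
  have first: "(3 * i + 3) mod 9 \<in> {b' (3 * i, 0), b' (3 * i, 2)}" if i: "i < 3" for i
  proof -
    have "b (3 * i + 1, 3 * 0 + 1) = 3 * ((i + 0) mod 3)" using c[unfolded centered_def, rule_format, OF i, of 0] by simp
    then have "b (3 * i + 1, 3 * 0 + 1) = 3 * i" using i by simp
    then have either: "(3 * i + 3) mod 9 \<in> {b (3 * i, 0), b (3 * i, 2)} \<or>
        (3 * i + 3) mod 9 \<in> {b (3 * i + 2, 0), b (3 * i + 2, 2)}"
      using magic_corners[OF MM_magic[OF b i zero_less_numeral]]
      by (simp only: mult_0_right add_0_right add_0_left) blast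
    have b'_top: "b' (3 * i, k) = b (if i \<in> E then 3 * i + 2 else 3 * i, k)" if "k < 9" for k
      using b'_eq[OF i, of 0 k] that by simp
    have E: "i \<in> E \<longleftrightarrow> (3 * i + 3) mod 9 \<notin> {b (3 * i, 0), b (3 * i, 2)}"
      unfolding E_def using i by blast
    show ?thesis
    proof (cases "i \<in> E")
      case True
      then have "(3 * i + 3) mod 9 \<in> {b (3 * i + 2, 0), b (3 * i + 2, 2)}" using E either by blast
      then show ?thesis using True by (simp add: b'_top)
    next
      case False
      then have "(3 * i + 3) mod 9 \<in> {b (3 * i, 0), b (3 * i, 2)}" using E by blast
      then show ?thesis using False by (simp add: b'_top)
    qed
  qed
  have "rows_aligned b'"
    unfolding rows_aligned_def
  proof (intro allI impI)
    fix i j :: nat assume i: "i < 3" and j: "j < 3"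
    have ctr: "b' (3 * i + 1, 3 * k + 1) = 3 * ((i + k) mod 3)" if "k < 3" for k
      using c' i that unfolding centered_def by blast
    have cand: "(b' (3 * i + 1, 3 * k + 1) + 3) mod 9 \<in> {b' (3 * i, 3 * k), b' (3 * i, 3 * k + 2)} \<or>
        (b' (3 * i + 1, 3 * k + 1) + 6) mod 9 \<in> {b' (3 * i, 3 * k), b' (3 * i, 3 * k + 2)}" if "k < 3" for k
      using magic_corners[OF MM_magic[OF b' i that]] unfolding add_0_right by blast
    have neq: "b' (3 * i, x) \<noteq> b' (3 * i, y)" if "x < 9" "y < 9" "x \<noteq> y" for x y
      using MM_row_eq[OF b', of "3 * i" x y] i that by simp
    have "b' (3 * i, x) = v \<Longrightarrow> b' (3 * i, y) \<noteq> v" if "x < 9" "y < 9" "x \<noteq> y" for x y v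
      using neq[OF that] by simp
    note neqs = this[of 0 3] this[of 0 5] this[of 0 6] this[of 0 8] this[of 2 3] this[of 2 5] this[of 2 6] this[of 2 8]
      this[of 3 6] this[of 3 8] this[of 5 6] this[of 5 8]
    \<comment> \<open>Let c0, c1, c2 be the centers along the band, each the previous one plus 3
      modulo 9. The top row has c1 in the first block, c2 or c0 in the second, and c0 or c1 in the
      third. As c1 is taken, the third block has c0 and hence the second has c2. The split on
      \<open>i\<close> only serves to evaluate the residues.\<close>
    have "i = 0 \<or> i = 1 \<or> i = 2" using i by arith
    then have "\<forall>j<3. (3 * (i + j) + 3) mod 9 \<in> {b' (3 * i, 3 * j), b' (3 * i, 3 * j + 2)}"
    proof (elim disjE)
      assume "i = 0"
      then show ?thesis
        using neqs first[OF i] cand[of 1] cand[of 2] ctr[of 1] ctr[of 2] by (simp add: all_less_3 numeral_2_eq_2[symmetric]) metis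
    next
      assume "i = 1"
      then show ?thesis
        using neqs first[OF i] cand[of 1] cand[of 2] ctr[of 1] ctr[of 2] by (simp add: all_less_3 numeral_2_eq_2[symmetric]) metis
    next
      assume "i = 2"
      then show ?thesis
        using neqs first[OF i] cand[of 1] cand[of 2] ctr[of 1] ctr[of 2] by (simp add: all_less_3 numeral_2_eq_2[symmetric]) metis
    qed
    then show "(3 * (i + j) + 3) mod 9 \<in> {b' (3 * i, 3 * j), b' (3 * i, 3 * j + 2)}" using j by blast
  qed
  moreover have "cols_aligned b \<longrightarrow> cols_aligned b'"
  proof
    assume a: "cols_aligned b"
    have "(3 * (i + j) + 3) mod 9 \<in> {b' (3 * i, 3 * j), b' (3 * i + 2, 3 * j)}" if "i < 3" "j < 3" for i j
      using a that b'_eq[of i 0 "3 * j"] b'_eq[of i 2 "3 * j"] by (cases "i \<in> E") (simp_all add: cols_aligned_def disj_commute)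
    then show "cols_aligned b'" by (simp add: cols_aligned_def)
  qed
  ultimately show ?thesis using r c' by blast
qed

definition aligned :: "(nat \<times> nat \<Rightarrow> nat) \<Rightarrow> bool" where
  "aligned b \<longleftrightarrow> b \<in> MM \<and> (\<forall>i<3. \<forall>j<3. b (3 * i + 1, 3 * j + 1) = 3 * ((i + j) mod 3) \<and>
     b (3 * i, 3 * j) = (3 * ((i + j) mod 3) + 3) mod 9)"

text \<open>Transposing between two alignments of rows turns the first one into an alignment of
  columns, which the second one preserves.\<close>

lemma ex_aligned:
  assumes b: "b \<in> MM"
  shows "\<exists>b'. reach b b' \<and> aligned b'"
proof -
  obtain b1 where b1: "reach b b1" "centered b1" using ex_centered[OF b] by blast
  then obtain b2 where b2: "reach b1 b2" "centered b2" "rows_aligned b2"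
    using ex_rows_aligned by (auto simp: reach_def)
  then have "b2 \<in> MM" by (simp add: reach_def)
  have t: "reach b2 (transposed b2)" by (rule reach_transposed) fact
  have "centered (transposed b2)"
    using b2(2) by (simp add: centered_def add.commute)
  moreover have "cols_aligned (transposed b2)"
    unfolding cols_aligned_def
  proof (intro allI impI)
    fix i j :: nat assume "i < 3" "j < 3"
    moreover from this have "(3 * (j + i) + 3) mod 9 \<in> {b2 (3 * j, 3 * i), b2 (3 * j, 3 * i + 2)}"
      using b2(3) unfolding rows_aligned_def by blast
    ultimately show "(3 * (i + j) + 3) mod 9 \<in> {transposed b2 (3 * i, 3 * j), transposed b2 (3 * i + 2, 3 * j)}"
      by (simp add: add.commute)
  qed
  ultimately obtain b3 where b3: "reach (transposed b2) b3" "centered b3" "rows_aligned b3" "cols_aligned b3"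
    using ex_rows_aligned t by (auto simp: reach_def)
  then have m: "b3 \<in> MM" by (simp add: reach_def)
  have "b3 (3 * i, 3 * j) = (3 * ((i + j) mod 3) + 3) mod 9" if ij: "i < 3" "j < 3" for i j
  proof -
    \<comment> \<open>The sought value lies in both corner pairs; as the top right and bottom left
      entries differ, it must be the shared top left one.\<close>
    have "b3 (3 * i, 3 * j + 2) \<noteq> b3 (3 * i + 2, 3 * j)"
      using magic_distinct[OF MM_magic[OF m ij]] by simp
    then have "b3 (3 * i, 3 * j) = (3 * (i + j) + 3) mod 9"
      using b3(3,4) ij unfolding rows_aligned_def cols_aligned_def by (metis insertE singletonD)
    also have "\<dots> = (3 * ((i + j) mod 3) + 3) mod 9"
      by (simp add: mod_mult_mult1[of 3 _ 3, simplified, symmetric] mod_simps)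
    finally show ?thesis .
  qed
  then have "aligned b3" using m b3(2) by (simp add: aligned_def centered_def)
  then show ?thesis using reach_trans[OF reach_trans[OF reach_trans[OF b1(1) b2(1)] t] b3(1)] by blast
qed

text \<open>In an aligned board the multiples of 3 are known, and the block in band \<open>i\<close> and pillar \<open>j\<close> depends
  only on \<open>k = (i + j) mod 3\<close> and on the entry \<open>\<beta>\<close> in the middle of its top row.\<close>

definition nf_block :: "nat \<Rightarrow> nat \<Rightarrow> nat list" where
  "nf_block k \<beta> = (let e = 3 * k; a = (3 * k + 3) mod 9; c = compl a \<beta>; i = compl a e; h = compl \<beta> e; g = compl c e
     in [a, \<beta>, c, compl a g, e, compl c i, g, h, i])"

text \<open>\<open>B\<close> holds the parameters \<beta> of the nine blocks as a 3 by 3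
  grid.\<close>

definition nf_entry :: "nat list list \<Rightarrow> nat \<Rightarrow> nat \<Rightarrow> nat" where
  "nf_entry B r c = nf_block ((r div 3 + c div 3) mod 3) (B ! (r div 3) ! (c div 3)) ! (3 * (r mod 3) + c mod 3)"

definition nf :: "nat list list \<Rightarrow> nat \<times> nat \<Rightarrow> nat" where
  "nf B = (\<lambda>(r, c)\<in>Cells. nf_entry B r c)"

definition "units = [1, 2, 4, 5, 7, 8 :: nat]"

text \<open>The predicates used in searches take tuples: pattern matching keeps \<open>code_simp\<close> from unfolding
  them at bound variables.\<close>

fun row_ok :: "nat \<Rightarrow> nat \<times> nat \<times> nat \<Rightarrow> bool" where
  "row_ok k (x, y, z) = distinct [x, y, z, compl ((3 * (k mod 3) + 3) mod 9) x,
     compl ((3 * ((k + 1) mod 3) + 3) mod 9) y, compl ((3 * ((k + 2) mod 3) + 3) mod 9) z]"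

text \<open>Compares two blocks of one pillar in their middle column:
  \<open>compl x (3 * (k mod 3))\<close> is the entry below the center of the block. Likewise
  \<open>row_ok\<close> looks only at the top row of a band. These necessary conditions already cut
  the candidates down to seven.\<close>

definition col_ok :: "nat \<Rightarrow> nat \<Rightarrow> nat \<Rightarrow> nat \<Rightarrow> bool" where
  "col_ok k x l y = distinct [x, compl x (3 * (k mod 3)), y, compl y (3 * (l mod 3))]"

fun pair_ok :: "nat \<Rightarrow> nat \<Rightarrow> (nat \<times> nat \<times> nat) \<times> (nat \<times> nat \<times> nat) \<Rightarrow> bool" where
  "pair_ok k l ((x, y, z), (x', y', z')) =
     (if col_ok k x l x' then if col_ok (k + 1) y (l + 1) y' then col_ok (k + 2) z (l + 2) z' else False else False)"

fun third_row_ok :: "(nat \<times> nat \<times> nat) \<times> ((nat \<times> nat \<times> nat) \<times> (nat \<times> nat \<times> nat)) \<Rightarrow> bool" where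
  "third_row_ok (p, q, r) = (if pair_ok 0 2 (p, r) then pair_ok 1 2 (q, r) else False)"

fun to_rows :: "(nat \<times> nat \<times> nat) \<times> (nat \<times> nat \<times> nat) \<times> (nat \<times> nat \<times> nat) \<Rightarrow> nat list list" where
  "to_rows ((x, y, z), (x', y', z'), (x'', y'', z'')) = [[x, y, z], [x', y', z'], [x'', y'', z'']]"

definition candidate_rows :: "nat \<Rightarrow> nat list \<Rightarrow> (nat \<times> nat \<times> nat) list" where
  "candidate_rows k xs = filter (row_ok k) (List.product xs (List.product units units))"

text \<open>Incompatible pairs of rows are discarded before a third row is tried. The list
  \<open>[1]\<close> reflects the normalization of the entry in cell (0, 1).\<close>

definition candidate_grids :: "((nat \<times> nat \<times> nat) \<times> (nat \<times> nat \<times> nat) \<times> (nat \<times> nat \<times> nat)) list" where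
  "candidate_grids = filter third_row_ok (concat (map (\<lambda>(p, q). List.product [p] (List.product [q] (candidate_rows 2 units)))
     (filter (pair_ok 0 1) (List.product (candidate_rows 0 [1]) (candidate_rows 1 units)))))"

definition solutions :: "nat list list list" where
  "solutions = [[[1,4,2],[4,7,5],[7,1,8]], [[1,4,7],[2,5,8],[5,8,2]], [[1,4,7],[2,5,8],[7,1,4]],
     [[1,4,7],[4,7,1],[5,8,2]], [[1,4,7],[4,7,1],[7,1,4]], [[1,8,2],[4,2,5],[7,5,8]], [[1,8,7],[4,2,1],[7,5,4]]]"

lemma candidate_grids_solutions: "\<forall>g\<in>set candidate_grids. to_rows g \<in> set solutions"
  by code_simp

text \<open>The relabelings generated by \<open>rho\<close> and \<open>mu 4 0\<close> as lists of
  values: the identity, \<open>mu 4 0\<close>, \<open>mu 7 0\<close>, \<open>rho\<close>,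
  \<open>rho\<close> after \<open>mu 4 0\<close>, \<open>rho\<close> after \<open>mu 7 0\<close>.
  The group is a symmetric group of degree 3. Indices in \<open>sol1_images\<close> refer to this
  order.\<close>

definition "S0_tables = [[0, 1, 2, 3, 4, 5, 6, 7, 8], [0, 4, 8, 3, 7, 2, 6, 1, 5], [0, 7, 5, 3, 1, 8, 6, 4, 2],
  [0, 2, 1, 3, 5, 4, 6, 8, 7], [0, 5, 7, 3, 8, 1, 6, 2, 4], [0, 8, 4, 3, 2, 7, 6, 5, 1 :: nat]]"


text \<open>Representatives of the orbits of size 27648 and 4608.\<close>

definition "sol1 = [[1,4,2],[4,7,5],[7,1,8 :: nat]]"
definition "sol2 = [[1,4,7],[4,7,1],[7,1,4 :: nat]]"

definition shift :: "nat \<Rightarrow> nat \<Rightarrow> nat" where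
  "shift k r = 3 * ((r div 3 + k) mod 3) + r mod 3"

text \<open>Cyclically permuting the bands and, in the opposite direction, the pillars keeps the centers
  of an aligned board in place; \<open>t\<close> tells whether the board is transposed first.\<close>

definition image_entry :: "nat list \<Rightarrow> nat \<Rightarrow> bool \<Rightarrow> nat \<Rightarrow> nat \<Rightarrow> nat" where
  "image_entry s k t r c = s ! (if t then nf_entry sol1 (shift k c) (shift (3 - k) r)
     else nf_entry sol1 (shift (3 - k) r) (shift k c))"

text \<open>Witnesses for the six equivalent normal forms: with each grid come an index into
  \<open>S0_tables\<close>, the amount of the cyclic shift and the transposition flag of a symmetry
  leading there from \<open>sol1\<close>. The first witness is the identity.\<close>

definition sol1_images :: "(nat list list \<times> nat \<times> nat \<times> bool) list" where
  "sol1_images = [([[1,4,2],[4,7,5],[7,1,8]], 0, 0, False), ([[1,4,7],[2,5,8],[5,8,2]], 1, 1, True),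
     ([[1,4,7],[2,5,8],[7,1,4]], 3, 2, True), ([[1,4,7],[4,7,1],[5,8,2]], 3, 0, True),
     ([[1,8,2],[4,2,5],[7,5,8]], 4, 2, False), ([[1,8,7],[4,2,1],[7,5,4]], 0, 1, False)]"

fun entry_ok :: "nat list list \<Rightarrow> nat list \<Rightarrow> nat \<Rightarrow> bool \<Rightarrow> nat \<times> nat \<Rightarrow> bool" where
  "entry_ok B s k t (r, c) \<longleftrightarrow> nf_entry B r c = image_entry s k t r c"

fun image_ok :: "nat list list \<times> nat \<times> nat \<times> bool \<Rightarrow> bool" where
  "image_ok (B, s, k, t) \<longleftrightarrow> list_all (entry_ok B (S0_tables ! s) k t) (List.product digits digits)"

lemma image_ok: "list_all image_ok sol1_images"
  by code_simp

lemma set_digits: "set digits = {0..<9}"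
  by (auto simp: digits_def)

lemma nf_apply [simp]: "r < 9 \<Longrightarrow> c < 9 \<Longrightarrow> nf B (r, c) = nf_entry B r c"
  by (simp add: nf_def)

lemma aligned_block:
  assumes b: "aligned b" and ij: "i < 3" "j < 3" and pq: "p < 3" "q < 3"
  shows "b (3 * i + p, 3 * j + q) = nf_block ((i + j) mod 3) (b (3 * i, 3 * j + 1)) ! (3 * p + q)"
proof -
  define x where "x = (\<lambda>p q. b (3 * i + p, 3 * j + q))"
  have x: "magic x" unfolding x_def using b by (intro MM_magic ij) (simp add: aligned_def)
  have x11: "x 1 1 = 3 * ((i + j) mod 3)" and x00: "x 0 0 = (x 1 1 + 3) mod 9"
    using b ij by (simp_all add: aligned_def x_def)
  have "nf_block ((i + j) mod 3) (x 0 1) = [x 0 0, x 0 1, x 0 2, x 1 0, x 1 1, x 1 2, x 2 0, x 2 1, x 2 2]"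
    unfolding nf_block_def Let_def x11[symmetric] x00[symmetric] by (simp only: magic_compl[OF x])
  moreover have "p = 0 \<or> p = 1 \<or> p = 2" "q = 0 \<or> q = 1 \<or> q = 2" using pq by arith+
  ultimately have "nf_block ((i + j) mod 3) (x 0 1) ! (3 * p + q) = x p q"
    by (elim disjE) simp_all
  then show ?thesis by (simp add: x_def)
qed

lemma aligned_units:
  assumes b: "aligned b" and ij: "i < 3" "j < 3"
  shows "b (3 * i, 3 * j + 1) \<in> set units"
proof -
  have x: "magic (\<lambda>p q. b (3 * i + p, 3 * j + q))" using b by (intro MM_magic ij) (simp add: aligned_def)
  have "b (3 * i + 0, 3 * j + 1) mod 3 \<noteq> 0"
    using magic_factsI[OF x] unfolding magic_facts_def by blast
  moreover have "b (3 * i + 0, 3 * j + 1) < 9"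
    using board_mem[OF MM_boards, of b "3 * i" "3 * j + 1"] b ij by (simp add: aligned_def Syms_def)
  ultimately show ?thesis unfolding units_def using less_9_digits[of "b (3 * i, 3 * j + 1)"] by (auto simp: digits_def)
qed

lemma aligned_row_ok:
  assumes b: "aligned b" and i: "i < 3"
  shows "row_ok i (b (3 * i, 1), b (3 * i, 4), b (3 * i, 7))"
proof -
  have m: "b \<in> MM" using b by (simp add: aligned_def)
  have "b (3 * i, 3 * j + 2) = compl ((3 * ((i + j) mod 3) + 3) mod 9) (b (3 * i, 3 * j + 1))" if "j < 3" for j
    using aligned_block[OF b i that, of 0 2] by (simp add: nf_block_def Let_def)
  from this[of 0] this[of 1] this[of 2]
  have "compl ((3 * (i mod 3) + 3) mod 9) (b (3 * i, 1)) = b (3 * i, 2)"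
    "compl ((3 * ((i + 1) mod 3) + 3) mod 9) (b (3 * i, 4)) = b (3 * i, 5)"
    "compl ((3 * ((i + 2) mod 3) + 3) mod 9) (b (3 * i, 7)) = b (3 * i, 8)"
    by (simp_all add: numeral_2_eq_2[symmetric])
  then show ?thesis
    using i unfolding row_ok.simps by (simp add: MM_row_eq[OF m])
qed

lemma aligned_col_ok:
  assumes b: "aligned b" and i: "i < 3" "i' < 3" "i \<noteq> i'" and j: "j < 3"
  shows "col_ok (i + j) (b (3 * i, 3 * j + 1)) (i' + j) (b (3 * i', 3 * j + 1))"
proof -
  have m: "b \<in> MM" using b by (simp add: aligned_def)
  have "compl (b (3 * k, 3 * j + 1)) (3 * ((k + j) mod 3)) = b (3 * k + 2, 3 * j + 1)" if "k < 3" for k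
    using aligned_block[OF b that j, of 2 1] by (simp add: nf_block_def Let_def)
  note c = this[OF i(1)] this[OF i(2)]
  show ?thesis
    unfolding col_ok_def c using i j by (simp add: MM_col_eq[OF m])
qed

lemma less_3_cases: "(n::nat) < 3 \<Longrightarrow> n = 0 \<or> n = 1 \<or> n = 2"
  by arith

lemma aligned_solution:
  assumes b: "aligned b" and one: "b (0, 1) = 1"
  shows "\<exists>B\<in>set solutions. b = nf B"
proof -
  define B where "B = (\<lambda>i j. b (3 * i, 3 * j + 1))"
  define g where "g = ((B 0 0, B 0 1, B 0 2), (B 1 0, B 1 1, B 1 2), (B 2 0, B 2 1, B 2 2))"
  have u: "B i j \<in> set units" if "i < 3" "j < 3" for i j
    unfolding B_def by (rule aligned_units[OF b that])
  have r: "row_ok i (B i 0, B i 1, B i 2)" if "i < 3" for i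
    using aligned_row_ok[OF b that] by (simp add: B_def)
  have c: "pair_ok i i' ((B i 0, B i 1, B i 2), (B i' 0, B i' 1, B i' 2))" if "i < 3" "i' < 3" "i \<noteq> i'" for i i'
    using aligned_col_ok[OF b that, of 0] aligned_col_ok[OF b that, of 1] aligned_col_ok[OF b that, of 2]
    by (simp add: B_def)
  have rows: "(B 0 0, B 0 1, B 0 2) \<in> set (candidate_rows 0 [1])" "(B 1 0, B 1 1, B 1 2) \<in> set (candidate_rows 1 units)"
    "(B 2 0, B 2 1, B 2 2) \<in> set (candidate_rows 2 units)"
    using u[of 0 1] u[of 0 2] u[of 1 0] u[of 1 1] u[of 1 2] u[of 2 0] u[of 2 1] u[of 2 2]
      r[of 0] r[of 1] r[of 2] one
    unfolding candidate_rows_def by (simp_all add: B_def image_iff del: row_ok.simps)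
  have "g \<in> set candidate_grids"
    unfolding candidate_grids_def g_def
    using rows c[of 0 1] c[of 0 2] c[of 1 2] by (simp del: pair_ok.simps add: image_iff)
  then have sol: "to_rows g \<in> set solutions" using candidate_grids_solutions by blast
  have entry: "to_rows g ! i ! j = b (3 * i, 3 * j + 1)" if "i < 3" "j < 3" for i j
    using less_3_cases[OF that(1)] less_3_cases[OF that(2)] by (elim disjE) (simp_all add: g_def B_def)
  have "b = nf (to_rows g)"
  proof (rule extensionalityI)
    show "b \<in> extensional Cells" using MM_boards[of b] b by (simp add: aligned_def PiE_iff)
    show "nf (to_rows g) \<in> extensional Cells" by (simp add: nf_def)
    show "b x = nf (to_rows g) x" if xC: "x \<in> Cells" for x
    proof -
      obtain r k where x: "x = (r, k)" "r < 9" "k < 9" using xC by (cases x) simp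
      have "b (3 * (r div 3) + r mod 3, 3 * (k div 3) + k mod 3) = nf_entry (to_rows g) r k"
        unfolding nf_entry_def entry[OF div3_less[OF x(2)] div3_less[OF x(3)]]
        by (rule aligned_block[OF b div3_less[OF x(2)] div3_less[OF x(3)] mod3_less mod3_less])
      then show ?thesis using x by simp
    qed
  qed
  with sol show ?thesis by blast
qed

text \<open>Being aligned constrains only the cells that hold multiples of 3, and these symbols are
  fixed by \<open>s\<close>.\<close>

lemma aligned_relabel:
  assumes b: "aligned b" and s: "s \<in> S0" "s 0 = 0" "s 3 = 3" "s 6 = 6"
  shows "reach b (relabel s b)" "aligned (relabel s b)"
proof -
  have m: "b \<in> MM" using b by (simp add: aligned_def)
  show r: "reach b (relabel s b)" by (rule reach_relabel[OF m s(1)])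
  have fix0: "s (3 * (n mod 3)) = 3 * (n mod 3)" "s ((3 * (n mod 3) + 3) mod 9) = (3 * (n mod 3) + 3) mod 9" for n
    using less_3_cases[OF mod3_less[of n]] s by auto
  show "aligned (relabel s b)"
    using b r fix0 by (simp add: aligned_def reach_def)
qed

lemma rho_S0: "rho \<in> S0" and mu_S0: "mu 4 0 \<in> S0"
  by (auto intro: generate.incl)

lemma ex_aligned_one:
  assumes "b \<in> MM"
  shows "\<exists>b'. reach b b' \<and> aligned b' \<and> b' (0, 1) = 1"
proof -
  define good where "good n \<longleftrightarrow> (\<forall>b. aligned b \<and> b (0, 1) = n \<longrightarrow> (\<exists>b'. reach b b' \<and> aligned b' \<and> b' (0, 1) = 1))" for n
  have step: "good n" if s: "s \<in> S0" "s 0 = 0" "s 3 = 3" "s 6 = 6" and good_s: "good (s n)" for s n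
    unfolding good_def
  proof (intro allI impI, elim conjE)
    fix b assume b: "aligned b" "b (0, 1) = n"
    then have "relabel s b (0, 1) = s n" by simp
    then obtain b' where "reach (relabel s b) b'" "aligned b'" "b' (0, 1) = 1"
      using good_s aligned_relabel(2)[OF b(1) s] unfolding good_def by blast
    then show "\<exists>b'. reach b b' \<and> aligned b' \<and> b' (0, 1) = 1"
      using reach_trans[OF aligned_relabel(1)[OF b(1) s]] by blast
  qed
  have mu: "good n" if "good (mu 4 0 n)" for n
    by (rule step[OF mu_S0 _ _ _ that]) (simp_all add: mu_def Syms_def)
  have rho: "good n" if "good (rho n)" for n
    by (rule step[OF rho_S0 _ _ _ that]) (simp_all add: rho_def Syms_def)
  \<comment> \<open>Multiplication by 4 leads from 4 to 7 to 1, and \<open>rho\<close> takes 2, 5, 8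
    to 1, 4, 7, so every unit is led to 1.\<close>
  have 1: "good 1" unfolding good_def using reach_refl by (auto simp: aligned_def)
  have 7: "good 7" by (rule mu) (use 1 in \<open>simp add: mu_def Syms_def\<close>)
  have 4: "good 4" by (rule mu) (use 7 in \<open>simp add: mu_def Syms_def\<close>)
  have "good 2" by (rule rho) (use 1 in \<open>simp add: rho_def Syms_def\<close>)
  moreover have "good 5" by (rule rho) (use 4 in \<open>simp add: rho_def Syms_def\<close>)
  moreover have "good 8" by (rule rho) (use 7 in \<open>simp add: rho_def Syms_def\<close>)
  ultimately have good: "good n" if "n \<in> set units" for n
    using 1 4 7 that by (auto simp: units_def)
  obtain b0 where "reach b b0" "aligned b0" using ex_aligned[OF assms] by blast
  moreover from this have "good (b0 (0, 1))" using aligned_units[of b0 0 0] good by simp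
  ultimately show ?thesis unfolding good_def using reach_trans by blast
qed

section \<open>The two representatives are modular-magic boards\<close>

fun nf_at :: "nat list list \<Rightarrow> nat \<times> nat \<Rightarrow> nat" where
  "nf_at B (r, c) = nf_entry B r c"

definition nf_row :: "nat list list \<Rightarrow> nat \<Rightarrow> nat list" where
  "nf_row B r = map (nf_at B) (List.product [r] digits)"

definition nf_col :: "nat list list \<Rightarrow> nat \<Rightarrow> nat list" where
  "nf_col B c = map (nf_at B) (List.product digits [c])"

fun nf_cells :: "nat list list \<Rightarrow> nat \<times> nat \<Rightarrow> nat list" where
  "nf_cells B (i, j) = map (nf_at B) (List.product [3 * i, 3 * i + 1, 3 * i + 2] [3 * j, 3 * j + 1, 3 * j + 2])"

fun magic_list :: "nat list \<Rightarrow> bool" where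
  "magic_list [a, b, c, d, e, f, g, h, i] =
     list_all (\<lambda>n. n mod 9 = 0) [a + b + c, d + e + f, g + h + i, a + d + g, b + e + h, c + f + i, a + e + i, c + e + g]"
| "magic_list _ = False"

definition nf_valid :: "nat list list \<Rightarrow> bool" where
  "nf_valid B \<longleftrightarrow>
     list_all (\<lambda>xs. distinct xs \<and> list_all (\<lambda>n. n < 9) xs) (map (nf_row B) digits) \<and>
     list_all distinct (map (nf_col B) digits) \<and>
     list_all (\<lambda>xs. distinct xs \<and> magic_list xs) (map (nf_cells B) (List.product [0, 1, 2] [0, 1, 2]))"

lemma nf_valid: "nf_valid sol1" "nf_valid sol2"
  by code_simp+

lemma distinct_digits_bij:
  assumes "distinct (map f digits)" "\<And>n. n < 9 \<Longrightarrow> f n < 9"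
  shows "bij_betw f {0..<9} Syms"
proof -
  have "inj_on f {0..<9}" using assms(1) by (simp add: distinct_map set_digits)
  moreover have "f ` {0..<9} \<subseteq> {0..<9}" using assms(2) by auto
  ultimately show ?thesis by (simp add: bij_betw_def endo_inj_surj Syms_def)
qed

lemma nf_MM:
  assumes "nf_valid B"
  shows "nf B \<in> MM"
proof -
  have less: "nf_entry B r c < 9" if "r < 9" "c < 9" for r c
    using assms that by (simp add: nf_valid_def nf_row_def list_all_iff set_digits)
  have rows: "bij_betw (\<lambda>c. nf B (r, c)) {0..<9} Syms" if "r < 9" for r
  proof -
    have "distinct (nf_row B r)"
      using assms that by (simp add: nf_valid_def list_all_iff set_digits)
    then have "distinct (map (nf_entry B r) digits)" by (simp add: nf_row_def comp_def)
    then have "bij_betw (nf_entry B r) {0..<9} Syms" by (rule distinct_digits_bij) (simp add: less that)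
    then show ?thesis by (rule bij_betw_cong[THEN iffD1, rotated]) (simp add: that)
  qed
  have col_distinct: "\<forall>xs\<in>set (map (nf_col B) digits). distinct xs"
    using assms unfolding nf_valid_def list_all_iff by blast
  have cols: "bij_betw (\<lambda>r. nf B (r, c)) {0..<9} Syms" if "c < 9" for c
  proof -
    have "distinct (nf_col B c)" using col_distinct that by (simp add: set_digits)
    then have "distinct (map (\<lambda>r. nf_entry B r c) digits)" by (simp add: nf_col_def digits_def)
    then have "bij_betw (\<lambda>r. nf_entry B r c) {0..<9} Syms" by (rule distinct_digits_bij) (simp add: less that)
    then show ?thesis by (rule bij_betw_cong[THEN iffD1, rotated]) (simp add: that)
  qed
  have cells: "distinct (nf_cells B (i, j)) \<and> magic_list (nf_cells B (i, j))" if "i < 3" "j < 3" for i j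
  proof -
    have "(i, j) \<in> set (List.product [0, 1, 2] [0, 1, 2])"
      using less_3_cases[OF that(1)] less_3_cases[OF that(2)] by (elim disjE) simp_all
    then show ?thesis using assms unfolding nf_valid_def list_all_iff set_map by blast
  qed
  have block: "bij_betw (nf B) (block i j) Syms" if ij: "i < 3" "j < 3" for i j
  proof -
    have eq: "nf_at B x = nf B x" if "x \<in> block i j" for x
      using ij that by (cases x) (simp add: block_def)
    have "set [3 * k, 3 * k + 1, 3 * k + 2] = {3 * k..<3 * k + 3}" for k :: nat by auto
    then have set: "set (List.product [3 * i, 3 * i + 1, 3 * i + 2] [3 * j, 3 * j + 1, 3 * j + 2]) = block i j"
      by (simp only: set_product block_def)
    have "inj_on (nf_at B) (block i j)"
      using cells[OF ij] unfolding nf_cells.simps distinct_map set by blast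
    then have inj: "inj_on (nf B) (block i j)" unfolding inj_on_def by (metis eq)
    have "nf B ` block i j = Syms"
    proof (rule card_subset_eq[OF finite_Syms])
      show "nf B ` block i j \<subseteq> Syms"
        using ij less by (auto simp: block_def Syms_def)
      show "card (nf B ` block i j) = card Syms"
        by (simp add: card_image[OF inj]) (simp add: block_def Syms_def)
    qed
    with inj show ?thesis by (simp add: bij_betw_def)
  qed
  have "lines (\<lambda>p q. nf B (3 * i + p, 3 * j + q))" if ij: "i < 3" "j < 3" for i j
  proof -
    have "magic_list (nf_cells B (i, j))" using cells[OF ij] by blast
    then have "lines (\<lambda>p q. nf_entry B (3 * i + p) (3 * j + q))"
      by (simp add: lines_iff)
    moreover have "nf B (3 * i + p, 3 * j + q) = nf_entry B (3 * i + p) (3 * j + q)" if "p < 3" "q < 3" for p q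
      using ij that by simp
    ultimately show ?thesis by (simp cong: lines_cong)
  qed
  moreover have "nf B \<in> Cells \<rightarrow>\<^sub>E Syms"
    using less by (auto simp: nf_def Syms_def PiE_iff)
  ultimately show ?thesis
    using rows cols block by (simp add: MM_def modmagic_iff sudoku_def is_board_def)
qed

lemma shift_permutation: "(\<lambda>i. if i < 3 then (i + k) mod 3 else i) permutes {0..<3::nat}"
proof (rule bij_imp_permutes)
  have "inj_on (\<lambda>i. (i + k) mod 3) {0..<3}"
  proof (rule inj_onI)
    fix x y :: nat assume "x \<in> {0..<3}" "y \<in> {0..<3}" "(x + k) mod 3 = (y + k) mod 3"
    then show "x = y" by (simp only: atLeastLessThan_iff) presburger
  qed
  then have "bij_betw (\<lambda>i. (i + k) mod 3) {0..<3} {0..<3}"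
    by (simp add: bij_betw_def endo_inj_surj image_subsetI)
  then show "bij_betw (\<lambda>i. if i < 3 then (i + k) mod 3 else i) {0..<3} {0..<3}"
    by (rule bij_betw_cong[THEN iffD1, rotated]) simp
qed simp

lemma shift_less: "shift k r < 9"
  unfolding shift_def by (rule triple_less) simp_all

lemma reach_shift:
  assumes b: "b \<in> MM"
  shows "reach b (pull (shift k) (shift l) b)"
proof -
  define \<sigma> where "\<sigma> k = (\<lambda>i. if i < 3 then (i + k) mod 3 else i)" for k :: nat
  note perm = shift_permutation[folded \<sigma>_def]
  have shift: "bandf (\<sigma> k) r = shift k r" if "r < 9" for k r
    using div3_less[OF that] by (simp add: bandf_def shift_def \<sigma>_def)
  define b' where "b' = pull (bandf (\<sigma> k)) id b"
  have r: "reach b b'" unfolding b'_def by (rule reach_bands[OF b perm])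
  then have "reach b' (pull id (bandf (\<sigma> l)) b')" by (intro reach_bands perm) (simp add: reach_def)
  moreover have "pull id (bandf (\<sigma> l)) b' = pull (shift k) (shift l) b"
    by (auto simp: pull_def b'_def fun_eq_iff shift shift_less)
  ultimately show ?thesis using reach_trans[OF r] by simp
qed

section \<open>Relabelings as tables, and the equivalence of six normal forms\<close>

definition table :: "(nat \<Rightarrow> nat) \<Rightarrow> nat list \<Rightarrow> bool" where
  "table s t \<longleftrightarrow> (\<forall>n<9. s n = t ! n)"

lemma table_iff: "table s t \<longleftrightarrow> list_all (\<lambda>n. s n = t ! n) digits"
  by (auto simp: table_def list_all_iff set_digits)

lemma table_rho: "table rho (S0_tables ! 3)"
  by (simp add: table_def S0_tables_def rho_nth)

lemma table_mu: "table (mu 4 0) (S0_tables ! 1)"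
  by (simp add: table_iff S0_tables_def mu_def Syms_def digits_def)

lemma S0_tables_wf: "list_all (list_all (\<lambda>n. n < 9)) S0_tables" "list_all (\<lambda>t. length t = 9) S0_tables"
  by code_simp+

fun compose_ok :: "nat list \<times> nat list \<Rightarrow> bool" where
  "compose_ok (t, t') \<longleftrightarrow> map ((!) t) t' \<in> set S0_tables"

lemma S0_tables_closed: "list_all compose_ok (List.product S0_tables S0_tables)"
  by code_simp

lemma table_compose:
  assumes "table x t" "table y t'" "t' \<in> set S0_tables"
  shows "table (compose Syms x y) (map ((!) t) t')"
proof -
  have "compose Syms x y n = map ((!) t) t' ! n" if n: "n < 9" for n
  proof -
    have "length t' = 9" "t' ! n < 9"
      using S0_tables_wf assms(3) n nth_mem[of n t'] unfolding list_all_iff by fastforce+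
    then show ?thesis using assms n by (simp add: table_def compose_def Syms_def)
  qed
  then show ?thesis by (simp add: table_def)
qed

text \<open>The relabelings described by one of the six tables form a subgroup containing both
  generators, so no word in the generators has to be analyzed.\<close>

lemma S0_table:
  assumes "s \<in> S0"
  obtains t where "t \<in> set S0_tables" "table s t"
proof -
  define T where "T = {s \<in> Bij Syms. \<exists>t\<in>set S0_tables. table s t}"
  have "subgroup T (BijGroup Syms)"
  proof (rule group.finite_subgroupI[OF group_BijGroup finite_BijGroup[OF finite_Syms]])
    show "T \<subseteq> carrier (BijGroup Syms)" by (auto simp: T_def carrier_BijGroup)
    have "table id_Syms (S0_tables ! 0)" by (simp add: table_iff digits_def S0_tables_def Syms_def)
    moreover have "S0_tables ! 0 \<in> set S0_tables" by (simp add: S0_tables_def)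
    ultimately show "\<one>\<^bsub>BijGroup Syms\<^esub> \<in> T" by (auto simp: T_def one_BijGroup id_Bij)
    show "x \<otimes>\<^bsub>BijGroup Syms\<^esub> y \<in> T" if xy: "x \<in> T" "y \<in> T" for x y
    proof -
      obtain t t' where t: "t \<in> set S0_tables" "table x t" "t' \<in> set S0_tables" "table y t'"
        using xy unfolding T_def by blast
      have "compose_ok (t, t')" using S0_tables_closed t(1,3) unfolding list_all_iff by auto
      then have "map ((!) t) t' \<in> set S0_tables" by simp
      moreover have "table (compose Syms x y) (map ((!) t) t')" by (rule table_compose[OF t(2,4,3)])
      ultimately show ?thesis
        using xy by (auto simp: T_def mult_BijGroup compose_Bij)
    qed
  qed
  moreover have "{rho, mu 4 0} \<subseteq> T"
    using table_rho table_mu rho_Bij mu_Bij[of 4 0] by (auto simp: T_def S0_tables_def)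
  ultimately have "S0 \<subseteq> T" by (intro group.generate_subgroup_incl[OF group_BijGroup])
  then show thesis using assms that by (auto simp: T_def)
qed

text \<open>Covers the indices that occur in \<open>sol1_images\<close>.\<close>

lemma table_S0:
  assumes "i \<in> {0, 1, 3, 4 :: nat}"
  obtains s where "s \<in> S0" "table s (S0_tables ! i)"
proof -
  have "compose Syms rho (mu 4 0) \<in> S0"
    using subgroup.m_closed[OF subgroup_S0 rho_S0 mu_S0] by (simp add: mult_BijGroup rho_Bij mu_Bij)
  moreover have "table (compose Syms rho (mu 4 0)) (S0_tables ! 4)"
    using table_compose[OF table_rho table_mu] by (simp add: S0_tables_def)
  moreover have "id_Syms \<in> S0" using subgroup.one_closed[OF subgroup_S0] by (simp add: one_BijGroup)
  moreover have "table id_Syms (S0_tables ! 0)" by (simp add: table_iff digits_def S0_tables_def Syms_def)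
  ultimately show thesis using assms that table_rho table_mu rho_S0 mu_S0 by blast
qed

lemma reach_image:
  assumes "(B, i, k, t) \<in> set sol1_images"
  shows "reach (nf sol1) (nf B)"
proof -
  have m: "nf sol1 \<in> MM" by (rule nf_MM[OF nf_valid(1)])
  have "i \<in> {0, 1, 3, 4}" using assms by (auto simp: sol1_images_def)
  then obtain s where s: "s \<in> S0" "table s (S0_tables ! i)" by (rule table_S0)
  have "image_ok (B, i, k, t)" using image_ok assms unfolding list_all_iff by blast
  then have entry: "nf_entry B r c = image_entry (S0_tables ! i) k t r c" if "r < 9" "c < 9" for r c
    using that unfolding image_ok.simps list_all_iff by (simp add: set_digits)
  have less: "nf_entry sol1 r c < 9" if "r < 9" "c < 9" for r c
    using board_mem[OF MM_boards[OF m] that] that by (simp add: Syms_def)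
  show ?thesis
  proof (cases t)
    case True
    \<comment> \<open>The transposition applied afterwards exchanges the coordinates, so the two
      shifts are swapped compared with the other case.\<close>
    define b where "b = pull (shift k) (shift (3 - k)) (nf sol1)"
    have r: "reach (nf sol1) b" unfolding b_def by (rule reach_shift[OF m])
    then have t: "reach b (transposed b)" by (intro reach_transposed) (simp add: reach_def)
    then have "reach (transposed b) (relabel s (transposed b))"
      by (intro reach_relabel s(1)) (simp add: reach_def)
    moreover have "relabel s (transposed b) = nf B"
      using s(2) True by (auto simp: fun_eq_iff relabel_def transposed_def nf_def b_def shift_less less
          entry image_entry_def table_def)
    ultimately show ?thesis using reach_trans[OF reach_trans[OF r t]] by simp
  next
    case False
    define b where "b = pull (shift (3 - k)) (shift k) (nf sol1)"
    have r: "reach (nf sol1) b" unfolding b_def by (rule reach_shift[OF m])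
    then have "reach b (relabel s b)"
      by (intro reach_relabel s(1)) (simp add: reach_def)
    moreover have "relabel s b = nf B"
      using s(2) False by (auto simp: fun_eq_iff relabel_def nf_def b_def shift_less less
          entry image_entry_def table_def)
    ultimately show ?thesis using reach_trans[OF r] by simp
  qed
qed

lemma reach_sol1_or_sol2:
  assumes b: "b \<in> MM"
  shows "reach (nf sol1) b \<or> reach (nf sol2) b"
proof -
  obtain b' where b': "reach b b'" "aligned b'" "b' (0, 1) = 1" using ex_aligned_one[OF b] by blast
  then obtain B where B: "B \<in> set solutions" "b' = nf B" using aligned_solution by blast
  have "\<forall>B\<in>set solutions. B = sol2 \<or> B \<in> set (map fst sol1_images)" by code_simp
  then consider "B = sol2" | i k t where "(B, i, k, t) \<in> set sol1_images" using B(1) by auto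
  then have "reach (nf sol1) b' \<or> reach (nf sol2) b'"
    using reach_image reach_refl[OF nf_MM[OF nf_valid(2)]] unfolding B(2) by cases blast+
  then show ?thesis using reach_trans[OF _ reach_sym[OF b'(1)]] by blast
qed

subsection \<open>The two orbits\<close>

text \<open>The rows and columns of blocks, 54 in all. Both directions are included so that
  transposition, too, permutes them.\<close>

definition minilines :: "(nat \<times> nat) set set" where
  "minilines = (\<lambda>(n, j). {n} \<times> {3 * j..<3 * j + 3}) ` ({0..<9} \<times> {0..<3}) \<union>
     (\<lambda>(n, j). {3 * j..<3 * j + 3} \<times> {n}) ` ({0..<9} \<times> {0..<3})"

definition miniline_sets :: "(nat \<times> nat \<Rightarrow> nat) \<Rightarrow> nat set set" where
  "miniline_sets b = (\<lambda>m. b ` m) ` minilines"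

fun minirow :: "nat \<times> nat \<Rightarrow> (nat \<times> nat) list" where
  "minirow (n, j) = List.product [n] [3 * j, 3 * j + 1, 3 * j + 2]"

fun minicol :: "nat \<times> nat \<Rightarrow> (nat \<times> nat) list" where
  "minicol (n, j) = List.product [3 * j, 3 * j + 1, 3 * j + 2] [n]"

definition miniline_cells :: "(nat \<times> nat) list list" where
  "miniline_cells = map minirow (List.product digits [0, 1, 2]) @ map minicol (List.product digits [0, 1, 2])"

lemma miniline_cells: "set ` set miniline_cells = minilines"
proof -
  have "set [0, 1, 2] = {0..<3::nat}" by auto
  then have idx: "set (List.product digits [0, 1, 2]) = {0..<9} \<times> {0..<3::nat}"
    by (simp only: set_product set_digits)
  have seg: "set [3 * j, 3 * j + 1, 3 * j + 2] = {3 * j..<3 * j + 3}" for j :: nat by auto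
  have "set (minirow x) = (case x of (n, j) \<Rightarrow> {n} \<times> {3 * j..<3 * j + 3})"
    "set (minicol x) = (case x of (n, j) \<Rightarrow> {3 * j..<3 * j + 3} \<times> {n})" for x
    by (cases x; simp only: minirow.simps minicol.simps set_product seg prod.case; simp)+
  then show ?thesis
    by (simp only: miniline_cells_def minilines_def set_append set_map idx image_Un image_image)
qed

lemma finite_minilines: "finite minilines"
  by (simp add: miniline_cells[symmetric])

lemma minilines_Cells: "m \<in> minilines \<Longrightarrow> m \<subseteq> Cells"
  by (auto simp: minilines_def Cells_def)

lemma wreath_minilines:
  assumes h: "h \<in> wreath_maps" and m: "m \<in> minilines"
  shows "h ` m \<in> minilines"
proof -
  obtain f g where fg: "wreath f" "wreath g" "h = cellmap f g \<or> h = tcellmap f g"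
    using h by (auto simp: wreath_maps_def)
  have seg: "\<exists>j'<3. f ` {3 * j..<3 * j + 3} = {3 * j'..<3 * j' + 3}" if "wreath f" "j < 3" for f j
    using wreath_segment[OF that] by (metis bij_betw_imp_surj_on)
  consider r j where "m = {r} \<times> {3 * j..<3 * j + 3}" "r < 9" "j < 3"
    | c j where "m = {3 * j..<3 * j + 3} \<times> {c}" "c < 9" "j < 3"
    using m by (auto simp: minilines_def)
  then show ?thesis
  proof cases
    case 1
    have "cellmap f g ` m = {f r} \<times> (g ` {3 * j..<3 * j + 3})"
      "tcellmap f g ` m = (f ` {3 * j..<3 * j + 3}) \<times> {g r}"
      using 1 by (force simp: cellmap_def tcellmap_def)+
    moreover obtain j1 j2 where "j1 < 3" "f ` {3 * j..<3 * j + 3} = {3 * j1..<3 * j1 + 3}"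
      "j2 < 3" "g ` {3 * j..<3 * j + 3} = {3 * j2..<3 * j2 + 3}"
      using seg[OF fg(1) 1(3)] seg[OF fg(2) 1(3)] by blast
    ultimately show ?thesis
      using fg(3) wreath_less[OF fg(1) 1(2)] wreath_less[OF fg(2) 1(2)]
      unfolding minilines_def by (elim disjE) auto
  next
    case 2
    have "cellmap f g ` m = (f ` {3 * j..<3 * j + 3}) \<times> {g c}"
      "tcellmap f g ` m = {f c} \<times> (g ` {3 * j..<3 * j + 3})"
      using 2 by (force simp: cellmap_def tcellmap_def)+
    moreover obtain j1 j2 where "j1 < 3" "f ` {3 * j..<3 * j + 3} = {3 * j1..<3 * j1 + 3}"
      "j2 < 3" "g ` {3 * j..<3 * j + 3} = {3 * j2..<3 * j2 + 3}"
      using seg[OF fg(1) 2(3)] seg[OF fg(2) 2(3)] by blast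
    ultimately show ?thesis
      using fg(3) wreath_less[OF fg(1) 2(2)] wreath_less[OF fg(2) 2(2)]
      unfolding minilines_def by (elim disjE) auto
  qed
qed

text \<open>The cell map permutes the minilines, and an injective relabeling keeps distinct symbol
  sets distinct. One inequality is enough to separate the representatives: an element of
  \<open>Gmm\<close> taking \<open>nf sol1\<close> to \<open>nf sol2\<close> would give 9 \<le>
  6.\<close>

lemma card_miniline_sets_mono:
  assumes g: "g \<in> Gmm" and b: "b \<in> MM"
  shows "card (miniline_sets b) \<le> card (miniline_sets (act g b))"
proof -
  obtain h s where hs: "g = (h, s)" "h \<in> Hmm" "s \<in> Smm" using g by (auto simp: Gmm_def)
  have h: "h \<in> wreath_maps" "h \<in> Bij Cells" using hs Hmm_sub H9_wreath H9_Bij by auto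
  have s: "s \<in> Bij Syms" using hs Smm_MM by (auto simp: MM_relabelings_def)
  have sub: "miniline_sets b \<subseteq> Pow Syms"
    using minilines_Cells PiE_mem[OF MM_boards[OF b]] by (fastforce simp: miniline_sets_def)
  have inj: "inj_on (image s) (miniline_sets b)"
    using inj_on_subset[OF inj_on_image_Pow[OF bij_betw_imp_inj_on[OF Bij_bij_betw[OF s]]] sub] .
  have "image s ` miniline_sets b \<subseteq> miniline_sets (act g b)"
  proof -
    have "s ` b ` m \<in> miniline_sets (act g b)" if m: "m \<in> minilines" for m
    proof -
      have "act g b ` (h ` m) = s ` b ` m"
        unfolding image_image
        by (rule image_cong[OF refl]) (use minilines_Cells[OF m] in \<open>auto simp: hs(1) act_apply[OF h(2)]\<close>)
      then show ?thesis using wreath_minilines[OF h(1) m] unfolding miniline_sets_def by (metis imageI)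
    qed
    then show ?thesis by (auto simp: miniline_sets_def)
  qed
  then have "card (image s ` miniline_sets b) \<le> card (miniline_sets (act g b))"
    by (intro card_mono) (simp_all add: miniline_sets_def finite_minilines)
  then show ?thesis by (simp add: card_image[OF inj])
qed

definition miniline_values :: "nat list list \<Rightarrow> nat list list" where
  "miniline_values B = map (map (nf_at B)) miniline_cells"

lemma miniline_sets_nf: "miniline_sets (nf B) = set (map set (miniline_values B))"
proof -
  have "nf B ` set m = set (map (nf_at B) m)" if "m \<in> set miniline_cells" for m
  proof -
    have "set m \<subseteq> Cells" using that minilines_Cells miniline_cells by blast
    then have "nf B ` set m = nf_at B ` set m"
      by (intro image_cong[OF refl]) auto
    then show ?thesis by simp
  qed
  then have "(\<lambda>m. nf B ` m) ` set ` set miniline_cells = (\<lambda>m. set (map (nf_at B) m)) ` set miniline_cells"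
    unfolding image_image by (rule image_cong[OF refl])
  then show ?thesis
    by (simp only: miniline_sets_def miniline_cells miniline_values_def set_map image_image)
qed

lemma card_miniline_sets: "card (miniline_sets (nf sol1)) = 9" "card (miniline_sets (nf sol2)) = 6"
  unfolding miniline_sets_nf by code_simp+

lemma not_same_orbit: "nf sol2 \<notin> orbit Gmm (nf sol1)"
proof
  assume "nf sol2 \<in> orbit Gmm (nf sol1)"
  then obtain g where "g \<in> Gmm" "nf sol2 = act g (nf sol1)" by (auto simp: orbit_iff)
  then show False
    using card_miniline_sets_mono[OF _ nf_MM[OF nf_valid(1)]] card_miniline_sets by fastforce
qed

text \<open>The multiples of 3 of the board \<open>nf sol1\<close> lie on the main diagonals of its blocks, those of its
  row reversal on the other diagonals, so only the centers are multiples of 3 in both.\<close>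

fun center_ok :: "nat \<times> nat \<Rightarrow> bool" where
  "center_ok (r, c) = (if nf_entry sol1 r c mod 3 = 0 then if nf_entry sol1 (flip (set [0, 1, 2]) r) c mod 3 = 0
     then r mod 3 = 1 \<and> c mod 3 = 1 else True else True)"

lemma center_ok: "list_all center_ok (List.product digits digits)"
  by code_simp

lemma Hmm_center:
  assumes h: "h \<in> Hmm" and x: "h (1, 1) = (r, c)"
  shows "r mod 3 = 1" "c mod 3 = 1"
proof -
  have hB: "h \<in> Bij Cells" using h Hmm_sub H9_Bij by auto
  define h' where "h' = (\<lambda>x\<in>Cells. inv_into Cells h x)"
  have h': "h' \<in> Hmm"
    using subgroup.m_inv_closed[OF subgroup_Hmm h] by (simp add: h'_def inv_BijGroup[OF hB])
  then have h'B: "h' \<in> Bij Cells" using Hmm_sub H9_Bij by auto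
  have "(r, c) \<in> Cells" using Bij_mem[OF hB, of "(1, 1)"] x by simp
  then have rc: "r < 9" "c < 9" by simp_all
  have h'_rc: "h' (r, c) = (1, 1)"
    using bij_betw_inv_into_left[OF Bij_bij_betw[OF hB], of "(1, 1)"] x rc by (simp add: h'_def)
  have mod3: "b (r, c) mod 3 = 0" if b: "b \<in> MM" for b
  proof -
    have "act (h', id_Syms) b \<in> MM" using h' b by (simp add: Hmm_def)
    from MM_center[OF this, of 0 0] have "act (h', id_Syms) b (h' (r, c)) mod 3 = 0"
      unfolding h'_rc by auto
    then show ?thesis
      using act_apply[OF h'B, of "(r, c)"] board_mem[OF MM_boards[OF b] rc] rc by simp
  qed
  have m: "nf sol1 \<in> MM" by (rule nf_MM[OF nf_valid(1)])
  have "flip {0, 1, 2} r < 9" using wreath_less[OF wreath_flip rc(1)] .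
  moreover have "pull (flip {0, 1, 2}) id (nf sol1) \<in> MM"
    by (rule MM_pull[OF mm_map_flip mm_map_id m])
  ultimately have "nf_entry sol1 r c mod 3 = 0" "nf_entry sol1 (flip (set [0, 1, 2]) r) c mod 3 = 0"
    using mod3[OF m] mod3[of "pull (flip {0, 1, 2}) id (nf sol1)"] rc by simp_all
  moreover have "center_ok (r, c)"
    using center_ok rc by (simp add: list_all_iff set_digits del: center_ok.simps)
  ultimately show "r mod 3 = 1" "c mod 3 = 1" by simp_all
qed

text \<open>A symmetry fixing a board sends its first two rows to the rows \<open>n\<close> and \<open>3 * (n div 3) + 1\<close> (or to
  two such columns), and only the pairs of vertically adjacent entries are compared.\<close>

fun row_match :: "nat list list \<Rightarrow> nat list list \<Rightarrow> nat list \<times> nat \<Rightarrow> bool" where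
  "row_match G C (t, n) = list_all (\<lambda>p. p \<in> set (zip (C ! n) (C ! (3 * (n div 3) + 1))))
     (zip (map ((!) t) (G ! 0)) (map ((!) t) (G ! 1)))"

definition row_matches :: "nat list list \<Rightarrow> nat list list \<Rightarrow> (nat list \<times> nat) list" where
  "row_matches G C = filter (row_match G C) (List.product S0_tables digits)"

lemma row_matches:
  "row_matches (map (nf_row sol1) digits) (map (nf_row sol1) digits) = [(S0_tables ! 0, 0)]"
  "row_matches (map (nf_row sol1) digits) (map (nf_col sol1) digits) = []"
  by code_simp+

text \<open>The test asks only that each vertical pair occur somewhere in the two target lines. The
  map \<open>g\<close> along these lines is thereby forgotten, and the search runs over relabelings
  and one line index alone.\<close>

lemma row_matchI:
  assumes F: "\<And>c. c < 9 \<Longrightarrow> g c < 9 \<and> t ! (G ! 0 ! c) = C ! n ! g c \<and> t ! (G ! 1 ! c) = C ! n' ! g c"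
    and n': "n' = 3 * (n div 3) + 1"
    and len: "length (G ! 0) = 9" "length (G ! 1) = 9" "length (C ! n) = 9" "length (C ! n') = 9"
  shows "row_match G C (t, n)"
  unfolding row_match.simps list_all_iff n'[symmetric]
proof
  fix p assume "p \<in> set (zip (map ((!) t) (G ! 0)) (map ((!) t) (G ! 1)))"
  then obtain c where c: "c < 9" "p = (t ! (G ! 0 ! c), t ! (G ! 1 ! c))"
    using len by (auto simp: set_zip)
  then have "p = zip (C ! n) (C ! n') ! g c" "g c < length (zip (C ! n) (C ! n'))"
    using F[OF c(1)] len by simp_all
  then show "p \<in> set (zip (C ! n) (C ! n'))" by (metis nth_mem)
qed

lemma nf_row_nth: "r < 9 \<Longrightarrow> c < 9 \<Longrightarrow> map (nf_row B) digits ! r ! c = nf_entry B r c"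
  and nf_col_nth: "r < 9 \<Longrightarrow> c < 9 \<Longrightarrow> map (nf_col B) digits ! c ! r = nf_entry B r c"
proof -
  have d: "digits ! n = n" "length digits = 9" if "n < 9" for n
    using less_9_digits[OF that] by (auto simp: digits_def)
  assume rc: "r < 9" "c < 9"
  show "map (nf_row B) digits ! r ! c = nf_entry B r c"
    using rc d(1)[OF rc(1)] d(1)[OF rc(2)] d(2)[OF rc(1)] by (simp add: nf_row_def product_nth)
  show "map (nf_col B) digits ! c ! r = nf_entry B r c"
    using rc d(1)[OF rc(1)] d(1)[OF rc(2)] d(2)[OF rc(1)] by (simp add: nf_col_def product_nth)
qed

lemma length_digits: "length digits = 9"
  by (simp add: digits_def)

lemma length_nf_row: "r < 9 \<Longrightarrow> length (map (nf_row B) digits ! r) = 9"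
  and length_nf_col: "r < 9 \<Longrightarrow> length (map (nf_col B) digits ! r) = 9"
  by (simp_all add: nf_row_def nf_col_def length_digits)

lemma stabilizer_trivial:
  assumes g: "g \<in> K0" and fix_g: "act g (nf sol1) = nf sol1"
  shows "g = \<one>\<^bsub>SymProd\<^esub>"
proof -
  obtain h s where hs: "g = (h, s)" "h \<in> Hmm" "s \<in> S0" using g by (auto simp: K0_def)
  have hB: "h \<in> Bij Cells" "h \<in> wreath_maps" using hs Hmm_sub H9_Bij H9_wreath by auto
  have sB: "s \<in> Bij Syms" using hs S0_Smm Smm_MM by (auto simp: MM_relabelings_def)
  have m: "nf sol1 \<in> MM" by (rule nf_MM[OF nf_valid(1)])
  obtain t where t: "t \<in> set S0_tables" "table s t" using S0_table[OF hs(3)] .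
  have less: "nf_entry sol1 r c < 9" if "r < 9" "c < 9" for r c
    using board_mem[OF MM_boards[OF m] that] that by (simp add: Syms_def)
  have eq: "nf sol1 (h (r, c)) = t ! nf_entry sol1 r c" if "r < 9" "c < 9" for r c
    using act_apply[OF hB(1), of "(r, c)" s "nf sol1"] that fix_g t(2) less[OF that]
    by (simp add: hs(1) table_def)
  \<comment> \<open>Indices 0 and 1 stay in one triple, and by \<open>Hmm_center\<close> the image
    of 1 is the middle of that triple. So the image of 0 determines the image of 1.\<close>
  have second: "f 1 = 3 * (f 0 div 3) + 1" if "wreath f" "f 1 mod 3 = 1" for f
    using wreath_div[OF that(1), of 0 1] that(2) div_mult_mod_eq[of "f 1" 3] by simp
  obtain f k where fk: "wreath f" "wreath k" "h = cellmap f k \<or> h = tcellmap f k"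
    using hB(2) by (auto simp: wreath_maps_def)
  note f_less = wreath_less[OF fk(1)] and k_less = wreath_less[OF fk(2)]
  from fk(3) show ?thesis
  proof
    assume h: "h = cellmap f k"
    then have "f 1 mod 3 = 1" using Hmm_center(1)[OF hs(2), of "f 1" "k 1"] by (simp add: cellmap_def)
    then have f1: "f 1 = 3 * (f 0 div 3) + 1" by (rule second[OF fk(1)])
    have e: "nf_entry sol1 (f r) (k c) = t ! nf_entry sol1 r c" if "r < 9" "c < 9" for r c
      using eq[OF that] that by (simp add: h cellmap_def f_less k_less)
    have "row_match (map (nf_row sol1) digits) (map (nf_row sol1) digits) (t, f 0)"
      by (rule row_matchI[where g = k, OF _ f1])
        (simp_all add: nf_row_nth length_nf_row f_less k_less e del: nth_map)
    then have "(t, f 0) \<in> set (row_matches (map (nf_row sol1) digits) (map (nf_row sol1) digits))"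
      using t(1) f_less[of 0] by (simp add: row_matches_def set_digits del: row_match.simps)
    then have t0: "t = S0_tables ! 0" and f0: "f 0 = 0" by (simp_all add: row_matches)
    have t_id: "t ! n = n" if "n < 9" for n
      using less_9_digits[OF that] by (auto simp: t0 S0_tables_def digits_def)
    \<comment> \<open>The relabeling is trivial and row 0 stays in place, so the distinct entries of
      row 0 fix every column; column 0 then fixes every row.\<close>
    have "k c = c" if "c < 9" for c
      using e[of 0 c] that MM_row_eq[OF m, of 0 "k c" c] by (simp add: f0 t_id less k_less)
    moreover from this have "f r = r" if "r < 9" for r
      using e[of r 0] that MM_col_eq[OF m, of "f r" r 0] by (simp add: t_id less f_less)
    ultimately have "h = (\<lambda>x\<in>Cells. x)" by (auto simp: h cellmap_def fun_eq_iff)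
    moreover have "s = id_Syms"
      using t(2) t_id Bij_imp_extensional[OF sB]
      by (auto simp: table_def fun_eq_iff Syms_def extensional_def)
    ultimately show ?thesis by (simp add: hs(1) SymProd_def one_BijGroup)
  next
    assume h: "h = tcellmap f k"
    then have "k 1 mod 3 = 1" using Hmm_center(2)[OF hs(2), of "f 1" "k 1"] by (simp add: tcellmap_def)
    then have k1: "k 1 = 3 * (k 0 div 3) + 1" by (rule second[OF fk(2)])
    have e: "nf_entry sol1 (f c) (k r) = t ! nf_entry sol1 r c" if "r < 9" "c < 9" for r c
      using eq[OF that] that by (simp add: h tcellmap_def f_less k_less)
    have "row_match (map (nf_row sol1) digits) (map (nf_col sol1) digits) (t, k 0)"
      by (rule row_matchI[where g = f, OF _ k1])
        (simp_all add: nf_row_nth nf_col_nth length_nf_row length_nf_col f_less k_less e del: nth_map)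
    then have "(t, k 0) \<in> set (row_matches (map (nf_row sol1) digits) (map (nf_col sol1) digits))"
      using t(1) k_less[of 0] by (simp add: row_matches_def set_digits del: row_match.simps)
    then show ?thesis by (simp add: row_matches)
  qed
qed

lemma inj_on_act: "inj_on (\<lambda>g. act g (nf sol1)) K0"
proof (rule inj_onI)
  interpret group SymProd by (rule group_SymProd)
  have bd: "nf sol1 \<in> Cells \<rightarrow>\<^sub>E Syms" by (rule MM_boards[OF nf_MM[OF nf_valid(1)]])
  fix g g' assume g: "g \<in> K0" "g' \<in> K0" and eq: "act g (nf sol1) = act g' (nf sol1)"
  have c: "g \<in> carrier SymProd" "g' \<in> carrier SymProd"
    using g subgroup.mem_carrier[OF subgroup_K0] by auto
  have i: "inv\<^bsub>SymProd\<^esub> g' \<in> K0" by (rule subgroup.m_inv_closed[OF subgroup_K0 g(2)])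
  have "act (inv\<^bsub>SymProd\<^esub> g' \<otimes>\<^bsub>SymProd\<^esub> g) (nf sol1) = act (inv\<^bsub>SymProd\<^esub> g') (act g' (nf sol1))"
    unfolding act_mult[OF inv_closed[OF c(2)] c(1) bd] eq ..
  also have "\<dots> = nf sol1"
    unfolding act_mult[OF inv_closed[OF c(2)] c(2) bd, symmetric] l_inv[OF c(2)] by (rule act_one[OF bd])
  finally have "inv\<^bsub>SymProd\<^esub> g' \<otimes>\<^bsub>SymProd\<^esub> g = \<one>\<^bsub>SymProd\<^esub>"
    by (rule stabilizer_trivial[OF subgroup.m_closed[OF subgroup_K0 i g(1)]])
  then show "g = g'"
    by (metis c inv_closed inv_equality inv_inv)
qed

lemma card_orbit_K0: "card (orbit K0 (nf sol1)) = card K0"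
proof -
  have "orbit K0 (nf sol1) = (\<lambda>g. act g (nf sol1)) ` K0" by (auto simp: orbit_iff)
  then show ?thesis by (simp only: card_image[OF inj_on_act])
qed

section \<open>Equality of orbits, their number, and minimality\<close>

lemma orbit_mono: "K \<subseteq> K' \<Longrightarrow> orbit K b \<subseteq> orbit K' b"
  unfolding orbit_def by blast

lemma orbit_Gmm_MM: "b \<in> MM \<Longrightarrow> orbit Gmm b \<subseteq> MM"
  by (auto simp: orbit_iff act_MM)

text \<open>Each board is reached under \<open>K0\<close> from one of the two representatives, and
  \<open>Gmm\<close> does not join these. Two boards related by \<open>Gmm\<close> thus have the
  same representative and are already related by \<open>K0\<close>.\<close>

lemma same_orbits_K0: "same_orbits K0"
  unfolding same_orbits_def
proof (rule ballI, rule equalityI[OF orbit_mono[OF K0_Gmm] subsetI])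
  have m: "nf sol1 \<in> MM" "nf sol2 \<in> MM" using nf_MM nf_valid by auto
  fix b b' assume b: "b \<in> MM" and b': "b' \<in> orbit Gmm b"
  have b'm: "b' \<in> MM" using orbit_Gmm_MM[OF b] b' by blast
  have sub: "c' \<in> orbit Gmm c" if "reach c c'" for c c'
    using that orbit_mono[OF K0_Gmm] by (auto simp: reach_def)
  have contra: False if "reach (nf sol1) c" "reach (nf sol2) c'" "c' \<in> orbit Gmm c" for c c'
  proof -
    have cm: "c \<in> MM" "c' \<in> MM" using that by (auto simp: reach_def)
    have "nf sol2 \<in> orbit Gmm c'" using sub[OF reach_sym[OF that(2)]] .
    then have "nf sol2 \<in> orbit Gmm c"
      by (rule orbit_trans[OF subgroup_Gmm MM_boards[OF cm(1)] that(3)])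
    then have "nf sol2 \<in> orbit Gmm (nf sol1)"
      by (rule orbit_trans[OF subgroup_Gmm MM_boards[OF m(1)] sub[OF that(1)]])
    then show False using not_same_orbit by blast
  qed
  have "b \<in> orbit Gmm b'" by (rule orbit_sym[OF subgroup_Gmm MM_boards[OF b] b'])
  then have "reach b b'"
    using reach_sol1_or_sol2[OF b] reach_sol1_or_sol2[OF b'm] contra b' reach_sym reach_trans by metis
  then show "b' \<in> orbit K0 b" by (simp add: reach_def)
qed

lemma orbits_eq: "{orbit Gmm b | b. b \<in> MM} = {orbit Gmm (nf sol1), orbit Gmm (nf sol2)}"
proof -
  have m: "nf sol1 \<in> MM" "nf sol2 \<in> MM" using nf_MM nf_valid by auto
  have "orbit Gmm b = orbit Gmm (nf sol1) \<or> orbit Gmm b = orbit Gmm (nf sol2)" if b: "b \<in> MM" for b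
  proof -
    have "orbit Gmm b = orbit Gmm c" if "c \<in> MM" "reach c b" for c
    proof (rule orbit_eq[OF subgroup_Gmm MM_boards[OF that(1)] MM_boards[OF b]])
      show "b \<in> orbit Gmm c" using that(2) orbit_mono[OF K0_Gmm] by (auto simp: reach_def)
    qed
    then show ?thesis using reach_sol1_or_sol2[OF b] m by blast
  qed
  then show ?thesis using m by blast
qed

theorem theorem2p3:
  shows "subgroup K0 SymProd \<and> K0 \<subseteq> Gmm
       \<and> same_orbits K0
       \<and> card {orbit Gmm b | b. b \<in> MM} = 2
       \<and> (\<forall>K. subgroup K SymProd \<and> K \<subseteq> Gmm \<and> card K < card K0 \<longrightarrow> \<not> same_orbits K)"
proof (intro conjI allI impI subgroup_K0 K0_Gmm same_orbits_K0)
  have m: "nf sol1 \<in> MM" "nf sol2 \<in> MM" using nf_MM nf_valid by auto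
  have "orbit Gmm (nf sol1) \<noteq> orbit Gmm (nf sol2)"
    using not_same_orbit orbit_refl[OF subgroup_Gmm MM_boards[OF m(2)]] by blast
  then show "card {orbit Gmm b | b. b \<in> MM} = 2" by (simp add: orbits_eq)
  fix K assume K: "subgroup K SymProd \<and> K \<subseteq> Gmm \<and> card K < card K0"
  show "\<not> same_orbits K"
  proof
    assume "same_orbits K"
    then have eq: "orbit K (nf sol1) = orbit K0 (nf sol1)"
      using same_orbits_K0 m(1) by (simp add: same_orbits_def)
    \<comment> \<open>Required for bounding the orbit by \<open>card K\<close>, as
      \<open>card\<close> is 0 on infinite sets.\<close>
    have "finite K"
      using K subgroup.subset[of K SymProd] finite_BijGroup[OF finite_Cells] finite_BijGroup[OF finite_Syms]
      by (auto simp: carrier_SymProd carrier_BijGroup intro: finite_subset)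
    moreover have "orbit K (nf sol1) = (\<lambda>g. act g (nf sol1)) ` K" by (auto simp: orbit_iff)
    ultimately have "card (orbit K (nf sol1)) \<le> card K" by (simp only: card_image_le)
    then show False using K by (simp add: eq card_orbit_K0)
  qed
qed

end
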